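(* Let $p$ be a prime greater than $11$. \begin{enumerate} \item Assume $\psi(p)$ is odd. (a) If $5^{\frac{p-1}{2}}\equiv -1 \pmod p$, then $\mathrm{mincol}_p\, THK(3,\psi(p))\le \frac{p+1}{2}$. (b) If $5^{\frac{p-1}{2}}\equiv 1 \pmod p$, then $\mathrm{mincol}_p\, THK(3,\psi(p))\le \frac{p-1}{2}$. \item Assume $\psi(p)$ is even. (a) If $4\mid\psi(p)$, then $\mathrm{mincol}_p\, THK(3,\psi(p))\le \psi(p)-1$. (b) If $4\nmid\psi(p)$, then $\mathrm{mincol}_p\, THK(3,\psi(p))\le \psi(p)-5$. \end{enumerate}
   Context: "Knot" means a knot or link in 3-space. $THK(3,n)$ is the closure of the 3-strand braid $(\sigma_2\sigma_1^{-1})^n\in B_3$. For an integer $r>1$, an $r$-coloring (Fox coloring) of a knot diagram is an assignment of elements of $\mathbb{Z}_r=\mathbb{Z}/r\mathbb{Z}$ to its arcs such that at each crossing $2y-x-z=0$ in $\mathbb{Z}_r$, where $y$ is the color of the over-arc and $x,z$ those of the two under-arcs. It is non-trivial if it uses at least two colors; existence of a non-trivial $r$-coloring does not depend on the diagram. If $K$ admits non-trivial $r$-colorings, let $n_{D,r}$ be the least number of distinct colors used in a non-trivial $r$-coloring of a diagram $D$ of $K$, and set $\mathrm{mincol}_r(K)=\min\{n_{D,r}: D \text{ a diagram of } K\}$. The integers $u_n$ ($n\ge 0$) are given by \[ u_n=\frac{1}{\sqrt5}\left[\left(\frac{1+\sqrt5}{2}\right)^{n+2}-\left(\frac{-1+\sqrt5}{2}\right)^{n}-\left(\frac{1-\sqrt5}{2}\right)^{n+2}+\left(\frac{-1-\sqrt5}{2}\right)^{n}\right],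 \] and for an integer $r>1$, $\psi(r):=\min\{q\in\mathbb{Z}^+ : r\mid u_{q-1}\}$. *)

theory Defs
  imports
    "HOL-Analysis.Analysis"
    "HOL-Number_Theory.Number_Theory"
    "HOL-Library.Extended_Nat"
begin

section \<open>Polygonal links and their diagrams\<close>

type_synonym point = "real \<times> real \<times> real"

type_synonym edge = "point \<times> point"

definition proj :: "point \<Rightarrow> real \<times> real" where
  "proj x = (fst x, fst (snd x))"

definition height :: "point \<Rightarrow> real" where
  "height x = snd (snd x)"

definition carrier_of :: "edge set \<Rightarrow> point set" where
  "carrier_of E = (\<Union>(a, b)\<in>E. closed_segment a b)"

text \<open>The conditions on \<^term>\<open>fst\<close> and \<^term>\<open>snd\<close> say that every vertex has exactly one
  outgoing and one incoming edge, so \<^term>\<open>E\<close> is a disjoint union of (oriented) closed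
  polygons. The orientation is only a device for listing each edge once; it is ignored by the
  notion of equivalence below, which concerns the carriers.\<close>

definition polygonal_link :: "edge set \<Rightarrow> bool" where
  "polygonal_link E \<longleftrightarrow>
     finite E \<and> E \<noteq> {} \<and> (\<forall>(a, b)\<in>E. a \<noteq> b) \<and>
     inj_on fst E \<and> inj_on snd E \<and> fst ` E = snd ` E \<and>
     (\<forall>(a, b)\<in>E. \<forall>(c, d)\<in>E. (a, b) \<noteq> (c, d) \<longrightarrow>
        closed_segment a b \<inter> closed_segment c d \<subseteq> {a, b} \<inter> {c, d})"

definition ambient_isotopic :: "point set \<Rightarrow> point set \<Rightarrow> bool" where
  "ambient_isotopic K L \<longleftrightarrow>
     (\<exists>H :: real \<Rightarrow> point \<Rightarrow> point.
        continuous_on ({0..1} \<times> UNIV) (\<lambda>(t, x). H t x) \<and>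
        (\<forall>t\<in>{0..1}. \<exists>g. homeomorphism UNIV UNIV (H t) g) \<and>
        (\<forall>x. H 0 x = x) \<and> H 1 ` K = L)"

definition fiber :: "edge set \<Rightarrow> real \<times> real \<Rightarrow> point set" where
  "fiber E q = {x \<in> carrier_of E. proj x = q}"

definition multiple_points :: "edge set \<Rightarrow> (real \<times> real) set" where
  "multiple_points E = {q. \<exists>x\<in>fiber E q. \<exists>y\<in>fiber E q. x \<noteq> y}"

text \<open>Regular position: finitely many multiple points, all of them double points, none of which
  is the image of a vertex. Since \<^term>\<open>card\<close> of an infinite set is \<open>0\<close>, this excludes
  vertical edges; and finiteness makes all crossings transverse.\<close>

definition regular_position :: "edge set \<Rightarrow> bool" where
  "regular_position E \<longleftrightarrow>
     finite (multiple_points E) \<and>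
     (\<forall>q\<in>multiple_points E. card (fiber E q) = 2 \<and> fiber E q \<inter> fst ` E = {})"

text \<open>A diagram, i.e. a regular projection with over/under information, is represented by the
  link in regular position that it is the projection of.\<close>

definition is_diagram_of :: "edge set \<Rightarrow> point set \<Rightarrow> bool" where
  "is_diagram_of E K \<longleftrightarrow>
     polygonal_link E \<and> regular_position E \<and> ambient_isotopic K (carrier_of E)"


section \<open>Fox colorings\<close>

text \<open>\<^term>\<open>crosses_over E y x\<close>: there is a crossing of the diagram at which \<^term>\<open>y\<close>
  lies on the over-strand and \<^term>\<open>x\<close> on the under-strand.\<close>

definition crosses_over :: "edge set \<Rightarrow> point \<Rightarrow> point \<Rightarrow> bool" where
  "crosses_over E y x \<longleftrightarrow>
     x \<in> carrier_of E \<and> y \<in> carrier_of E \<and> proj x = proj y \<and> height x < height y"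

text \<open>The arcs of the diagram, lifted to the link: the pieces into which the link is cut by
  removing its under-crossing points.\<close>

definition arcs :: "edge set \<Rightarrow> point set set" where
  "arcs E = components (carrier_of E - {x. \<exists>y. crosses_over E y x})"

text \<open>\<^term>\<open>\<int>\<close>/r is represented by the residues \<open>0, \<dots>, r - 1\<close>. At an under-crossing
  point \<^term>\<open>x\<close> in the interior of the edge from \<^term>\<open>a\<close> to \<^term>\<open>b\<close>, the two
  under-arcs are the arcs \<^term>\<open>A\<close> and \<^term>\<open>B\<close> that contain all points of the edge
  sufficiently close to \<^term>\<open>x\<close> on the side of \<^term>\<open>a\<close> and of \<^term>\<open>b\<close>,
  respectively (possibly \<open>A = B\<close>).\<close>

definition fox_coloring :: "nat \<Rightarrow> edge set \<Rightarrow> (point set \<Rightarrow> int) \<Rightarrow> bool" where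
  "fox_coloring r E c \<longleftrightarrow>
     c ` arcs E \<subseteq> {0..<int r} \<and>
     (\<forall>(a, b)\<in>E. \<forall>x\<in>open_segment a b. \<forall>y. crosses_over E y x \<longrightarrow>
       (\<forall>A\<in>arcs E. \<forall>B\<in>arcs E. \<forall>C\<in>arcs E.
          (\<forall>\<^sub>F t in at_right 0. x + t *\<^sub>R (a - x) \<in> A) \<and>
          (\<forall>\<^sub>F t in at_right 0. x + t *\<^sub>R (b - x) \<in> B) \<and>
          y \<in> C \<longrightarrow>
          [2 * c C - c A - c B = 0] (mod int r)))"

definition num_colors :: "edge set \<Rightarrow> (point set \<Rightarrow> int) \<Rightarrow> nat" where
  "num_colors E c = card (c ` arcs E)"

definition nontrivial_coloring :: "nat \<Rightarrow> edge set \<Rightarrow> (point set \<Rightarrow> int) \<Rightarrow> bool" where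
  "nontrivial_coloring r E c \<longleftrightarrow> fox_coloring r E c \<and> num_colors E c \<ge> 2"

text \<open>Both minima are taken in the extended natural numbers, where the infimum of the empty set is
  \<open>\<infinity>\<close>: a finite bound on \<open>mincol r K\<close> includes the claim that \<open>K\<close> admits
  non-trivial \<open>r\<close>-colorings, and a diagram without such colorings (there is none if
  \<open>K\<close> admits them) does not contribute to the minimum.\<close>

definition diagram_mincol :: "nat \<Rightarrow> edge set \<Rightarrow> enat" where
  "diagram_mincol r E = (INF c\<in>{c. nontrivial_coloring r E c}. enat (num_colors E c))"

definition mincol :: "nat \<Rightarrow> point set \<Rightarrow> enat" where
  "mincol r K = (INF E\<in>{E. is_diagram_of E K}. diagram_mincol r E)"


section \<open>Closed braids and Turk's head knots\<close>

text \<open>A braid word on \<open>s\<close> strands is a list of integers of absolute value between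
  \<open>1\<close> and \<open>s - 1\<close>: \<open>i > 0\<close> stands for \<open>\<sigma>\<^sub>i\<close> and \<open>-i\<close> for
  its inverse. The \<open>k\<close>-th letter (counted from \<open>0\<close>) is drawn between the lines
  \<open>y = k\<close> and \<open>y = k + 1\<close>, the strands starting and ending at
  \<open>x = 1, \<dots>, s\<close>. In \<open>\<sigma>\<^sub>i\<close> the strand going from position \<open>i\<close> to
  \<open>i + 1\<close> passes over; the opposite convention replaces closed braids by their mirror
  images, which makes no difference for the closures of
  \<open>(\<sigma>\<^sub>2 \<sigma>\<^sub>1\<^sup>-\<^sup>1)\<^sup>n\<close>, as conjugation by the half twist exchanges
  \<open>\<sigma>\<^sub>1\<close> and \<open>\<sigma>\<^sub>2\<close>.\<close>

definition under_strand :: "real \<Rightarrow> real \<Rightarrow> real \<Rightarrow> edge set" where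
  "under_strand y x x' = {((x, y, 0), (x', y + 1, 0))}"

text \<open>The same plane segment, lifted by an extra vertex that avoids the crossing in the middle.\<close>

definition over_strand :: "real \<Rightarrow> real \<Rightarrow> real \<Rightarrow> edge set" where
  "over_strand y x x' =
     (let v = (x + (x' - x) / 3, y + 1 / 3, 1)
      in {((x, y, 0), v), (v, (x', y + 1, 0))})"

definition letter_edges :: "nat \<Rightarrow> nat \<Rightarrow> int \<Rightarrow> edge set" where
  "letter_edges s k l =
     (let i = nat \<bar>l\<bar>; y = real k in
      (\<Union>j\<in>{1..s} - {i, i + 1}. under_strand y (real j) (real j)) \<union>
      (if l > 0
       then over_strand y (real i) (real i + 1) \<union> under_strand y (real i + 1) (real i)
       else under_strand y (real i) (real i + 1) \<union> over_strand y (real i + 1) (real i)))"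

text \<open>The closing strand from the top of position \<open>j\<close> (at \<open>y = m\<close>) back to its bottom (at
  \<open>y = 0\<close>) runs around the right-hand side of the braid; these strands are nested.\<close>

definition closing_strand :: "nat \<Rightarrow> nat \<Rightarrow> nat \<Rightarrow> edge set" where
  "closing_strand s m j =
     (let x = real j; y = real m; d = real s + 1 - real j;
          v1 = (x, y, 0); v2 = (x, y + d, 0); v3 = (real s + d, y + d, 0);
          v4 = (real s + d, - d, 0); v5 = (x, - d, 0); v6 = (x, 0, 0)
      in {(v1, v2), (v2, v3), (v3, v4), (v4, v5), (v5, v6)})"

definition closed_braid :: "nat \<Rightarrow> int list \<Rightarrow> edge set" where
  "closed_braid s w =
     (\<Union>k<length w. letter_edges s k (w ! k)) \<union>
     (\<Union>j\<in>{1..s}. closing_strand s (length w) j)"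

definition THK3 :: "nat \<Rightarrow> point set" where
  "THK3 n = carrier_of (closed_braid 3 (concat (replicate n [2, -1])))"


section \<open>The integers \<open>u\<^sub>n\<close> and the function \<open>\<psi>\<close>\<close>

definition u_real :: "nat \<Rightarrow> real" where
  "u_real n = 1 / sqrt 5 *
     (((1 + sqrt 5) / 2) ^ (n + 2) - ((- 1 + sqrt 5) / 2) ^ n
      - ((1 - sqrt 5) / 2) ^ (n + 2) + ((- 1 - sqrt 5) / 2) ^ n)"

text \<open>The floor only serves to change the type: \<^term>\<open>u_real n\<close> is an integer, as shown in
  \<open>of_int_u_int\<close> below.\<close>

definition u_int :: "nat \<Rightarrow> int" where
  "u_int n = \<lfloor>u_real n\<rfloor>"

lemma u_real_fib: "u_real n = of_int (int (fib (n + 2)) + (- 1) ^ n * int (fib n))"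
proof -
  have "(- 1 + sqrt 5) / 2 = - 1 * ((1 - sqrt 5) / 2)" "(- 1 - sqrt 5) / 2 = - 1 * ((1 + sqrt 5) / 2)"
    by (simp_all add: field_simps)
  then have "((- 1 + sqrt 5) / 2) ^ n = (- 1) ^ n * ((1 - sqrt 5) / 2) ^ n"
    "((- 1 - sqrt 5) / 2) ^ n = (- 1) ^ n * ((1 + sqrt 5) / 2) ^ n"
    by (simp_all only: power_mult_distrib)
  then show ?thesis
    unfolding u_real_def by (simp add: fib_closed_form diff_divide_distrib algebra_simps del: fib.simps power_Suc)
qed

lemma of_int_u_int: "of_int (u_int n) = u_real n"
  by (simp add: u_int_def u_real_fib del: of_int_add of_int_mult)

definition psi :: "nat \<Rightarrow> nat" where
  "psi r = (LEAST q. q > 0 \<and> int r dvd u_int (q - 1))"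

end

theory Submission
  imports Defs
begin

text \<open>
  All bounds are obtained on the standard diagram of the closed braid. A coloring of that diagram is a
  sequence \<open>c\<close> of residues with \<open>c\<^bsub>k+3\<^esub> + c\<^sub>k = 2 c\<^bsub>k+2\<^esub>\<close> and period \<open>2 n\<close>, whose range is the set of
  colors (\<open>mincol_THK3_le\<close>): every crossing of the alternating diagram starts one new arc, and the
  arcs are listed in this order. The recurrence is solved by constants and by sequences with the
  Fibonacci recurrence, so the task is to find such a sequence modulo \<open>p\<close> with period \<open>2 \<psi>(p)\<close> and
  few values.

  If \<open>\<psi>(p)\<close> is odd, then \<open>t\<^sup>2 = t + 1\<close> has a root in \<open>\<int>/p\<close> that is a square, and its powers
  are a coloring with at most \<open>(p - 1) / 2\<close> colors, which proves both bounds of this case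
  (\<open>odd_psi_coloring\<close>). If \<open>\<psi>(p)\<close> is even, the coloring is the Fibonacci sequence itself. It
  satisfies \<open>F\<^bsub>m+q\<^esub> = - F\<^sub>m\<close> for \<open>q = \<psi>(p)\<close>; together with the reflection \<open>m \<mapsto> - m\<close> this leaves about
  \<open>q / 2\<close> values at even and at odd indices each (\<open>fib_range_card\<close>), and the values that occur at
  indices of both parities account for the remaining improvement (\<open>even_psi_coloring\<close>).

  The geometric part shows that the polygon defining the closed braid is in regular position with one
  double point for each letter, and that suitable colors of its vertices determine a Fox coloring of
  its arcs (\<open>vertex_coloring_extends\<close>).
\<close>

section \<open>Colorings from vertex colors\<close>

text \<open>Values on finitely many closed pieces that agree on overlaps are constant on a connected set: the
  pieces with one value and the remaining ones would otherwise separate it into two closed sets.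
  Working with pieces and values avoids choosing a function on points that would be ill-defined at
  the under-crossings, where two colors meet.\<close>

lemma connected_constant_on_closed_pieces:
  fixes A :: "'a::topological_space set"
  assumes "connected A" "finite I" "\<And>i. i \<in> I \<Longrightarrow> closed (P i)" "A \<subseteq> (\<Union>i\<in>I. P i)"
    and agree: "\<And>i j x. i \<in> I \<Longrightarrow> j \<in> I \<Longrightarrow> x \<in> A \<Longrightarrow> x \<in> P i \<Longrightarrow> x \<in> P j \<Longrightarrow> v i = v j"
    and "i \<in> I" "j \<in> I" "P i \<inter> A \<noteq> {}" "P j \<inter> A \<noteq> {}"
  shows "v i = v j"
proof (rule ccontr)
  assume ne: "v i \<noteq> v j"
  let ?X = "\<Union>l\<in>{l\<in>I. v l = v i}. P l" and ?Y = "\<Union>l\<in>{l\<in>I. v l \<noteq> v i}. P l"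
  have "closed ?X" "closed ?Y"
    using assms(2,3) by (auto intro!: closed_UN)
  moreover have "A \<subseteq> ?X \<union> ?Y" using assms(4) by blast
  moreover have "?X \<inter> ?Y \<inter> A = {}"
  proof (intro equals0I, elim IntE UN_E CollectE conjE)
    fix x l m assume "l \<in> I" "m \<in> I" "x \<in> A" "x \<in> P l" "x \<in> P m" "v l = v i" "v m \<noteq> v i"
    then show False using agree[of l m x] by simp
  qed
  moreover have "?X \<inter> A \<noteq> {}" using assms(6,8) by blast
  moreover have "?Y \<inter> A \<noteq> {}" using assms(7,9) ne by fastforce
  ultimately show False using connected_closedD[OF \<open>connected A\<close>, of ?X ?Y] by metis
qed

text \<open>Fox colorings are functions on arcs, which are connected components and therefore awkward to
  name. A color for each vertex is all that has to be given: an edge passing under nothing keeps the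
  color of its ends, and an edge passing under another one is cut at the crossing into two halves,
  each with the color of its own end. These halves are the pieces of the preceding lemma. Pieces of
  different edges meet only in vertices, and two halves of an edge only in the crossing, so each arc gets one color. All vertex
  colors occur, since regular position keeps vertices away from crossings and so puts every vertex on
  some arc.\<close>

lemma vertex_coloring_extends:
  fixes v :: "point \<Rightarrow> int"
  assumes link: "polygonal_link E" and reg: "regular_position E"
    and rng: "v ` fst ` E \<subseteq> {0..<int r}"
    and one: "\<And>a b x x' y y'. (a, b) \<in> E \<Longrightarrow> x \<in> closed_segment a b \<Longrightarrow> x' \<in> closed_segment a b \<Longrightarrow>
      crosses_over E y x \<Longrightarrow> crosses_over E y' x' \<Longrightarrow> x = x'"
    and const: "\<And>a b. (a, b) \<in> E \<Longrightarrow> (\<And>x y. x \<in> closed_segment a b \<Longrightarrow> \<not> crosses_over E y x) \<Longrightarrow> v a = v b"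
    and cross: "\<And>a b d e x y. (a, b) \<in> E \<Longrightarrow> (d, e) \<in> E \<Longrightarrow> x \<in> closed_segment a b \<Longrightarrow>
      y \<in> closed_segment d e \<Longrightarrow> crosses_over E y x \<Longrightarrow>
      v d = v e \<and> [2 * v d - v a - v b = 0] (mod int r)"
  obtains c where "fox_coloring r E c" "c ` arcs E = v ` fst ` E"
proof -
  define U where "U = {x. \<exists>y. crosses_over E y x}"
  define S where "S = carrier_of E - U"
  define h where "h e = (SOME x. x \<in> closed_segment (fst e) (snd e) \<inter> U)" for e :: edge
  define cut where "cut e \<longleftrightarrow> closed_segment (fst e) (snd e) \<inter> U \<noteq> {}" for e :: edge
  \<comment> \<open>Piece \<open>(e, True)\<close> is the half of \<open>e\<close> at its start, \<open>(e, False)\<close> the half at its end;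
    both are all of \<open>e\<close> if it is not cut.\<close>
  define P where "P i = (case i of (e, first) \<Rightarrow>
      if \<not> cut e then closed_segment (fst e) (snd e)
      else if first then closed_segment (fst e) (h e) else closed_segment (h e) (snd e))"
    for i :: "edge \<times> bool"
  define w where "w i = (case i of (e, first) \<Rightarrow> if first then v (fst e) else v (snd e))"
    for i :: "edge \<times> bool"
  define I where "I = E \<times> (UNIV :: bool set)"
  have finE: "finite E" and snd_fst: "snd ` E = fst ` E"
    using link by (auto simp: polygonal_link_def)
  have meet: "closed_segment (fst e) (snd e) \<inter> closed_segment (fst f) (snd f)
      \<subseteq> {fst e, snd e} \<inter> {fst f, snd f}"
    if "e \<in> E" "f \<in> E" "e \<noteq> f" for e f
  proof -
    have "\<forall>(a, b)\<in>E. \<forall>(c, d)\<in>E. (a, b) \<noteq> (c, d) \<longrightarrow>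
        closed_segment a b \<inter> closed_segment c d \<subseteq> {a, b} \<inter> {c, d}"
      using link unfolding polygonal_link_def by (elim conjE)
    from bspec[OF this that(1)] have "\<forall>(c, d)\<in>E. e \<noteq> (c, d) \<longrightarrow>
        closed_segment (fst e) (snd e) \<inter> closed_segment c d \<subseteq> {fst e, snd e} \<inter> {c, d}"
      by (simp only: case_prod_beta prod.collapse)
    from bspec[OF this that(2)] that(3) show ?thesis
      by (simp only: case_prod_beta prod.collapse simp_thms)
  qed
  have vertex_not_U: "a \<notin> U" if "a \<in> fst ` E" for a
  proof
    assume "a \<in> U"
    then obtain y where y: "crosses_over E y a" by (auto simp: U_def)
    then have "a \<in> fiber E (proj a)" "y \<in> fiber E (proj a)" "a \<noteq> y"
      by (auto simp: crosses_over_def fiber_def)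
    then have "proj a \<in> multiple_points E" by (auto simp: multiple_points_def)
    then have "fiber E (proj a) \<inter> fst ` E = {}" using reg by (auto simp: regular_position_def)
    with \<open>a \<in> fiber E (proj a)\<close> that show False by blast
  qed
  have ends: "fst e \<in> fst ` E" "snd e \<in> fst ` E" if "e \<in> E" for e
    using that snd_fst by blast+
  have h_eq: "h e = x" if "e \<in> E" "x \<in> closed_segment (fst e) (snd e)" "x \<in> U" for e x
  proof -
    have "h e \<in> closed_segment (fst e) (snd e) \<inter> U"
      unfolding h_def by (rule someI[of _ x]) (use that in auto)
    then show ?thesis using one[of "fst e" "snd e" "h e" x] that by (auto simp: U_def)
  qed
  have h: "h e \<in> closed_segment (fst e) (snd e)" "h e \<in> U" if "e \<in> E" "cut e" for e
    using that h_eq unfolding cut_def by blast+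
  have uncut: "v (fst e) = v (snd e)" if "e \<in> E" "\<not> cut e" for e
    by (rule const) (use that in \<open>auto simp: cut_def U_def\<close>)
  have cover: "\<exists>first. x \<in> P (e, first)" if "e \<in> E" "x \<in> closed_segment (fst e) (snd e)" for e x
  proof (cases "cut e")
    case True
    then have "x \<in> closed_segment (fst e) (h e) \<union> closed_segment (h e) (snd e)"
      using Un_closed_segment[OF h(1)] that by blast
    then show ?thesis using True by (auto simp: P_def split: if_splits)
  qed (use that in \<open>auto simp: P_def\<close>)
  have P_sub: "x \<in> closed_segment (fst e) (snd e)" if "e \<in> E" "x \<in> P (e, i)" for e x i
    using that Un_closed_segment[OF h(1)[OF that(1)]] unfolding P_def by (cases "cut e"; cases i) auto
  have w_same: "w (e, i) = w (e, j)" if "e \<in> E" "x \<in> S" "x \<in> P (e, i)" "x \<in> P (e, j)" for e i j x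
  proof (cases "cut e")
    case True
    have "x \<noteq> h e" using that(2) h(2)[OF that(1) True] by (auto simp: S_def)
    then show ?thesis
      using that True Int_closed_segment[OF disjI1[OF h(1)[OF that(1) True]]]
      by (cases i; cases j) (auto simp: P_def)
  next
    case False
    then show ?thesis using uncut that by (auto simp: w_def)
  qed
  have w_vertex: "w (e, i) = v x" if "e \<in> E" "x \<in> {fst e, snd e}" "x \<in> P (e, i)" for e i x
  proof -
    have "x \<in> fst ` E" using that(2) ends[OF that(1)] by blast
    moreover have "x \<in> carrier_of E"
      using that(1) P_sub[OF that(1,3)] by (auto simp: carrier_of_def split_beta)
    ultimately have xS: "x \<in> S" using vertex_not_U by (simp add: S_def)
    have "fst e \<in> P (e, True)" "snd e \<in> P (e, False)" by (auto simp: P_def)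
    then show ?thesis
      using w_same[OF that(1) xS that(3), of True] w_same[OF that(1) xS that(3), of False] that(2)
      by (auto simp: w_def)
  qed
  have agree: "w i = w j" if ij_in: "i \<in> I" "j \<in> I" and x: "x \<in> S" "x \<in> P i" "x \<in> P j" for i j x
  proof -
    obtain e k f l where ij: "i = (e, k)" "j = (f, l)" "e \<in> E" "f \<in> E"
      using ij_in unfolding I_def by blast
    show ?thesis
    proof (cases "e = f")
      case True
      then show ?thesis using w_same x ij by blast
    next
      case False
      have "x \<in> closed_segment (fst e) (snd e)" "x \<in> closed_segment (fst f) (snd f)"
        using P_sub x ij by blast+
      then have "x \<in> {fst e, snd e}" "x \<in> {fst f, snd f}"
        using meet[OF ij(3,4) False] by blast+
      then show ?thesis using w_vertex x ij by metis
    qed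
  qed
  have arcs_S: "arcs E = components S"
    by (simp add: arcs_def S_def U_def)
  have arc: "connected A" "A \<subseteq> S" "A \<noteq> {}" if "A \<in> arcs E" for A
    using that in_components_connected in_components_subset in_components_nonempty
    unfolding arcs_S by blast+
  define c where "c A = (SOME m. \<exists>i\<in>I. P i \<inter> A \<noteq> {} \<and> m = w i)" for A
  have c_eq: "c A = w i" if "A \<in> arcs E" "i \<in> I" "x \<in> A" "x \<in> P i" for A i x
  proof -
    have A: "connected A" "A \<subseteq> S"
      using arc that by blast+
    have "\<exists>j\<in>I. P j \<inter> A \<noteq> {} \<and> c A = w j"
      unfolding c_def by (rule someI[of _ "w i"]) (use that in auto)
    then obtain j where j: "j \<in> I" "P j \<inter> A \<noteq> {}" "c A = w j" by blast
    have "w j = w i"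
    proof (rule connected_constant_on_closed_pieces[of A I P w])
      show "closed (P i)" for i by (auto simp: P_def split_beta)
      show "A \<subseteq> (\<Union>i\<in>I. P i)"
      proof
        fix x assume "x \<in> A"
        then obtain e where "e \<in> E" "x \<in> closed_segment (fst e) (snd e)"
          using A by (auto simp: S_def carrier_of_def split_beta)
        then show "x \<in> (\<Union>i\<in>I. P i)" using cover unfolding I_def by blast
      qed
      show "finite I" using finE by (simp add: I_def)
      show "P i \<inter> A \<noteq> {}" using that by blast
      show "w i = w j" if "i \<in> I" "j \<in> I" "x \<in> A" "x \<in> P i" "x \<in> P j" for i j x
        using agree[OF that(1,2) _ that(4,5)] that(3) A(2) by blast
    qed (use A(1) that(2) j in simp_all)
    then show ?thesis using j by simp
  qed
  have crossing_relation: "[2 * c C - c A - c B = 0] (mod int r)"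
    if ab: "(a, b) \<in> E" and x: "x \<in> open_segment a b" and cr: "crosses_over E y x"
      and ABC: "A \<in> arcs E" "B \<in> arcs E" "C \<in> arcs E"
      and ev: "\<forall>\<^sub>F t in at_right 0. x + t *\<^sub>R (a - x) \<in> A" "\<forall>\<^sub>F t in at_right 0. x + t *\<^sub>R (b - x) \<in> B"
      and yC: "y \<in> C" for a b x y A B C
  proof -
    have x': "x \<in> closed_segment a b" "x \<in> U" using x cr unfolding open_segment_def U_def by blast+
    have cut: "cut (a, b)" "h (a, b) = x"
      using h_eq[of "(a, b)" x] ab x' by (auto simp: cut_def)
    \<comment> \<open>The under-arcs are prescribed by germs at the crossing, so it suffices to find one point of each
      on the corresponding half edge.\<close>
    have near: "\<exists>t\<in>{0<..1}. x + t *\<^sub>R (z - x) \<in> D"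
      if "\<forall>\<^sub>F t in at_right 0. x + t *\<^sub>R (z - x) \<in> D" for z and D :: "point set"
    proof -
      have "\<forall>\<^sub>F t in at_right (0::real). t \<in> {0<..1}"
        by (rule eventually_at_rightI[of 0 1]) auto
      with that have "\<forall>\<^sub>F t in at_right 0. x + t *\<^sub>R (z - x) \<in> D \<and> t \<in> {0<..1}"
        by (rule eventually_conj)
      then show ?thesis using eventually_happens'[OF trivial_limit_at_right_real] by blast
    qed
    have seg: "x + t *\<^sub>R (z - x) \<in> closed_segment x z" if "t \<in> {0<..1}" for t z
      unfolding in_segment using that by (intro exI[of _ t]) (auto simp: algebra_simps)
    obtain t where t: "t \<in> {0<..1}" "x + t *\<^sub>R (a - x) \<in> A" using near[OF ev(1)] by blast
    have cA: "c A = v a"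
      using c_eq[OF ABC(1) _ t(2), of "((a, b), True)"] seg[OF t(1), of a] cut ab
      by (auto simp: P_def w_def I_def closed_segment_commute)
    obtain s where s: "s \<in> {0<..1}" "x + s *\<^sub>R (b - x) \<in> B" using near[OF ev(2)] by blast
    have cB: "c B = v b"
      using c_eq[OF ABC(2) _ s(2), of "((a, b), False)"] seg[OF s(1), of b] cut ab
      by (auto simp: P_def w_def I_def)
    obtain d e where de: "(d, e) \<in> E" "y \<in> closed_segment d e"
      using cr by (auto simp: crosses_over_def carrier_of_def)
    have cr': "v d = v e" "[2 * v d - v a - v b = 0] (mod int r)"
      using cross[OF ab de(1) x'(1) de(2) cr] by auto
    obtain k where "y \<in> P ((d, e), k)" using cover[of "(d, e)" y] de by auto
    then have "c C = v d" using c_eq[OF ABC(3) _ yC, of "((d, e), k)"] de cr'(1)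
      by (auto simp: I_def w_def)
    then show "[2 * c C - c A - c B = 0] (mod int r)" using cA cB cr' by simp
  qed
  have img: "c ` arcs E = v ` fst ` E"
  proof (intro equalityI subsetI)
    fix m assume "m \<in> c ` arcs E"
    then obtain A where A: "A \<in> arcs E" "m = c A" by blast
    then obtain x where x: "x \<in> A" "x \<in> S"
      using arc by blast
    then obtain e where e: "e \<in> E" "x \<in> closed_segment (fst e) (snd e)"
      by (auto simp: S_def carrier_of_def split_beta)
    then obtain k where "x \<in> P (e, k)" using cover by blast
    then have "m = w (e, k)" using c_eq[OF A(1) _ x(1)] A e by (auto simp: I_def)
    then show "m \<in> v ` fst ` E" using ends[OF e(1)] by (auto simp: w_def)
  next
    fix m assume "m \<in> v ` fst ` E"
    then obtain e where e: "e \<in> E" "m = v (fst e)" by blast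
    have "fst e \<in> carrier_of E" using e by (auto simp: carrier_of_def split_beta intro!: bexI[of _ e])
    then have "fst e \<in> S" using ends[OF e(1)] vertex_not_U by (simp add: S_def)
    then obtain A where A: "A \<in> arcs E" "fst e \<in> A"
      unfolding arcs_S by (metis Union_components UnionE)
    have "c A = w (e, True)"
      by (rule c_eq[OF A(1) _ A(2)]) (use e in \<open>auto simp: I_def P_def\<close>)
    then have "m = c A" using e by (simp add: w_def)
    then show "m \<in> c ` arcs E" using A by blast
  qed
  have "fox_coloring r E c"
    unfolding fox_coloring_def case_prod_beta
  proof (intro conjI ballI allI impI; (elim conjE)?)
    show "c ` arcs E \<subseteq> {0..<int r}" using img rng by simp
  next
    fix e x y A B C
    assume "e \<in> E" "x \<in> open_segment (fst e) (snd e)" "crosses_over E y x"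
      "A \<in> arcs E" "B \<in> arcs E" "C \<in> arcs E"
      "\<forall>\<^sub>F t in at_right 0. x + t *\<^sub>R (fst e - x) \<in> A"
      "\<forall>\<^sub>F t in at_right 0. x + t *\<^sub>R (snd e - x) \<in> B" "y \<in> C"
    then show "[2 * c C - c A - c B = 0] (mod int r)"
      by (intro crossing_relation[of "fst e" "snd e" x y A B C]) simp_all
  qed
  then show ?thesis using that img by blast
qed

text \<open>Every link in regular position is a diagram of itself, by the constant isotopy.\<close>

lemma mincol_le_num_colors:
  assumes "polygonal_link E" "regular_position E" "fox_coloring r E c" "num_colors E c \<ge> 2"
  shows "mincol r (carrier_of E) \<le> enat (num_colors E c)"
proof -
  have "ambient_isotopic (carrier_of E) (carrier_of E)"
    unfolding ambient_isotopic_def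
    by (rule exI[of _ "\<lambda>t x. x"])
      (auto intro!: continuous_intros exI[of _ "\<lambda>x. x"] simp: homeomorphism_def split_beta)
  with assms have "is_diagram_of E (carrier_of E)" "nontrivial_coloring r E c"
    by (auto simp: is_diagram_of_def nontrivial_coloring_def)
  then show ?thesis
    unfolding mincol_def diagram_mincol_def by (intro INF_lower2[of E] INF_lower) auto
qed

section \<open>The edges of the Turk's head diagram\<close>

text \<open>The letters of the braid word alternate between \<open>\<sigma>\<^sub>2\<close> and \<open>\<sigma>\<^sub>1\<^sup>-\<^sup>1\<close>, and the levels of
  the diagram are alike up to reflection in the line \<open>x = 2\<close>: at level \<open>k\<close> the over-strand always starts
  in the middle and moves to the side \<open>2 + side k\<close>, while the strand from that side moves to the middle
  below it. With the sign \<open>side k\<close> all levels can be treated at once.\<close>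

definition side :: "nat \<Rightarrow> real" where
  "side k = (if even k then 1 else - 1)"

definition apex :: "nat \<Rightarrow> point" where
  "apex k = (2 + side k / 3, real k + 1 / 3, 1)"

definition straight :: "nat \<Rightarrow> edge" where
  "straight k = ((2 - side k, real k, 0), (2 - side k, real k + 1, 0))"

definition under_edge :: "nat \<Rightarrow> edge" where
  "under_edge k = ((2 + side k, real k, 0), (2, real k + 1, 0))"

definition over_lo :: "nat \<Rightarrow> edge" where
  "over_lo k = ((2, real k, 0), apex k)"

definition over_hi :: "nat \<Rightarrow> edge" where
  "over_hi k = (apex k, (2 + side k, real k + 1, 0))"

definition level :: "nat \<Rightarrow> edge set" where
  "level k = {straight k, under_edge k, over_lo k, over_hi k}"

definition under_pt :: "nat \<Rightarrow> point" where
  "under_pt k = (2 + side k / 2, real k + 1 / 2, 0)"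

definition over_pt :: "nat \<Rightarrow> point" where
  "over_pt k = (2 + side k / 2, real k + 1 / 2, 3 / 4)"

definition turks_head :: "nat \<Rightarrow> edge set" where
  "turks_head n = (\<Union>k<2 * n. level k) \<union> (\<Union>j\<in>{1, 2, 3}. closing_strand 3 (2 * n) j)"

lemma side_Suc: "side (Suc k) = - side k"
  by (simp add: side_def)

lemma side_cases: obtains "side k = 1" | "side k = - 1"
  by (cases "even k") (simp_all add: side_def)

lemmas edge_defs = straight_def under_edge_def over_lo_def over_hi_def apex_def

lemma nth_concat_replicate_pair:
  "k < 2 * n \<Longrightarrow> concat (replicate n [a, b]) ! k = (if even k then a else b)"
proof (induction n arbitrary: k)
  case (Suc n)
  then show ?case by (cases k; cases "k - 1") auto
qed simp

lemma letter_edges_level: "letter_edges 3 k (if even k then 2 else - 1) = level k"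
proof (cases "even k")
  case True
  have "{1..3} - {nat \<bar>2\<bar>, nat \<bar>2\<bar> + 1} = {1}" by auto
  moreover have "under_strand (real k) (real 1) (real 1) = {straight k}"
    "over_strand (real k) (real (nat \<bar>2\<bar>)) (real (nat \<bar>2\<bar>) + 1) = {over_lo k, over_hi k}"
    "under_strand (real k) (real (nat \<bar>2\<bar>) + 1) (real (nat \<bar>2\<bar>)) = {under_edge k}"
    using True by (simp_all add: under_strand_def over_strand_def edge_defs side_def Let_def)
  ultimately show ?thesis
    using True unfolding letter_edges_def level_def Let_def by auto
next
  case False
  have "{1..3} - {nat \<bar>- 1\<bar>, nat \<bar>- 1\<bar> + 1} = {3}" by auto
  moreover have "under_strand (real k) (real 3) (real 3) = {straight k}"
    "over_strand (real k) (real (nat \<bar>- 1\<bar>) + 1) (real (nat \<bar>- 1\<bar>)) = {over_lo k, over_hi k}"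
    "under_strand (real k) (real (nat \<bar>- 1\<bar>)) (real (nat \<bar>- 1\<bar>) + 1) = {under_edge k}"
    using False by (simp_all add: under_strand_def over_strand_def edge_defs side_def Let_def)
  ultimately show ?thesis
    using False unfolding letter_edges_def level_def Let_def by auto
qed

lemma closed_braid_turks_head: "closed_braid 3 (concat (replicate n [2, -1])) = turks_head n"
proof -
  have "length (concat (replicate n [2, -1 :: int])) = 2 * n"
    by (induction n) auto
  moreover have "letter_edges 3 k (concat (replicate n [2, -1]) ! k) = level k" if "k < 2 * n" for k
    using letter_edges_level[of k] by (simp add: nth_concat_replicate_pair[OF that])
  moreover have "{1..3::nat} = {1, 2, 3}" by auto
  ultimately show ?thesis by (simp add: closed_braid_def turks_head_def)
qed

lemma turks_head_cases:
  assumes "e \<in> turks_head n"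
  obtains (level) k where "k < 2 * n" "e \<in> level k"
  | (closing) j where "j \<in> {1, 2, 3}" "e \<in> closing_strand 3 (2 * n) j"
  using assms by (auto simp: turks_head_def)

section \<open>General position of the edges\<close>

lemma in_segment_triple:
  fixes a1 a2 a3 b1 b2 b3 :: real
  shows
  "(x, y, h) \<in> closed_segment (a1, a2, a3) (b1, b2, b3) \<longleftrightarrow>
    (\<exists>u. 0 \<le> u \<and> u \<le> 1 \<and> x = a1 + u * (b1 - a1) \<and> y = a2 + u * (b2 - a2) \<and> h = a3 + u * (b3 - a3))"
  unfolding in_segment by (auto simp: algebra_simps)

lemma segment_bounds:
  fixes a1 a2 a3 b1 b2 b3 :: real
  assumes "(x, y, h) \<in> closed_segment (a1, a2, a3) (b1, b2, b3)"
  shows "min a1 b1 \<le> x \<and> x \<le> max a1 b1 \<and> min a2 b2 \<le> y \<and> y \<le> max a2 b2 \<and> min a3 b3 \<le> h \<and> h \<le> max a3 b3"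
proof -
  have between: "min a b \<le> a + u * (b - a) \<and> a + u * (b - a) \<le> max a b" if "0 \<le> u" "u \<le> 1" for a b u :: real
  proof -
    have "a + u * (b - a) \<in> closed_segment a b"
      unfolding in_segment using that by (auto intro!: exI[of _ u] simp: algebra_simps)
    then show ?thesis by (auto simp: closed_segment_eq_real_ivl split: if_splits)
  qed
  obtain u where u: "0 \<le> u" "u \<le> 1"
    and eqs: "x = a1 + u * (b1 - a1)" "y = a2 + u * (b2 - a2)" "h = a3 + u * (b3 - a3)"
    using assms unfolding in_segment_triple by blast
  show ?thesis unfolding eqs using between[OF u] by blast
qed

lemma in_straight:
  assumes "(x, y, h) \<in> closed_segment (fst (straight k)) (snd (straight k))"
  shows "x = 2 - side k \<and> real k \<le> y \<and> y \<le> real k + 1 \<and> h = 0"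
  using assms by (auto simp: edge_defs in_segment_triple)

lemma in_under:
  assumes "(x, y, h) \<in> closed_segment (fst (under_edge k)) (snd (under_edge k))"
  shows "x = 2 + side k * (k + 1 - y) \<and> real k \<le> y \<and> y \<le> real k + 1 \<and> h = 0"
  using assms by (auto simp: edge_defs in_segment_triple algebra_simps)

lemma in_over_lo:
  assumes "(x, y, h) \<in> closed_segment (fst (over_lo k)) (snd (over_lo k))"
  shows "x = 2 + side k * (y - k) \<and> k \<le> y \<and> y \<le> k + 1 / 3 \<and> h = 3 * (y - k)"
  using assms by (auto simp: edge_defs in_segment_triple algebra_simps)

lemma in_over_hi:
  assumes "(x, y, h) \<in> closed_segment (fst (over_hi k)) (snd (over_hi k))"
  shows "x = 2 + side k * (y - k) \<and> real k + 1 / 3 \<le> y \<and> y \<le> real k + 1 \<and> h = 3 / 2 * (real k + 1 - y)"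
  using assms by (cases k rule: side_cases) (auto simp: edge_defs in_segment_triple field_simps)

lemma level_points:
  assumes "e \<in> level k" "(x, y, h) \<in> closed_segment (fst e) (snd e)"
  shows "e = straight k \<and> x = 2 - side k \<and> real k \<le> y \<and> y \<le> real k + 1 \<and> h = 0 \<or>
    e = under_edge k \<and> x = 2 + side k * (real k + 1 - y) \<and> real k \<le> y \<and> y \<le> real k + 1 \<and> h = 0 \<or>
    e = over_lo k \<and> x = 2 + side k * (y - real k) \<and> real k \<le> y \<and> y \<le> real k + 1 / 3 \<and> h = 3 * (y - real k) \<or>
    e = over_hi k \<and> x = 2 + side k * (y - real k) \<and> real k + 1 / 3 \<le> y \<and> y \<le> real k + 1 \<and>
      h = 3 / 2 * (real k + 1 - y)"
  using assms in_straight[of x y h k] in_under[of x y h k] in_over_lo[of x y h k] in_over_hi[of x y h k]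
  unfolding level_def by blast

text \<open>A level touches the rest of the diagram only along its two horizontal boundary lines, and there
  only in vertices. This reduces comparisons with other levels and with the closing strands to the
  coordinate \<open>y\<close>.\<close>

lemma level_boundary:
  assumes "e \<in> level k" "(x, y, h) \<in> closed_segment (fst e) (snd e)"
  shows "real k \<le> y \<and> y \<le> real k + 1 \<and> 1 \<le> x \<and> x \<le> 3 \<and>
    (y = real k \<longrightarrow> (x, y, h) = fst e \<and> h = 0) \<and> (y = real k + 1 \<longrightarrow> (x, y, h) = snd e \<and> h = 0)"
  using level_points[OF assms]
  by (cases k rule: side_cases; elim disjE conjE) (simp_all add: edge_defs)

text \<open>In the coordinates \<open>t\<close> (distance from the lower boundary line of the level) and \<open>s\<close> (signed distance
  from the line \<open>x = 2\<close>) the over-strand is \<open>s = t\<close>, the under-strand \<open>s = 1 - t\<close> and the third strand \<open>s = - 1\<close>. So projections meet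
  only at \<open>t = 1 / 2\<close>, which is the crossing, and at the common vertex \<open>t = 1 / 3\<close> of the two over-edges.\<close>

lemma level_crossing:
  assumes "e \<in> level k" "f \<in> level k" "e \<noteq> f"
    and "(x, y, h) \<in> closed_segment (fst e) (snd e)" "(x, y, h') \<in> closed_segment (fst f) (snd f)"
  shows "(h = h' \<and> (x, y, h) \<in> {fst e, snd e} \<inter> {fst f, snd f}) \<or>
    e = under_edge k \<and> f = over_hi k \<and> (x, y, h) = under_pt k \<and> (x, y, h') = over_pt k \<or>
    f = under_edge k \<and> e = over_hi k \<and> (x, y, h) = over_pt k \<and> (x, y, h') = under_pt k"
proof -
  define t where "t = y - real k"
  define s where "s = side k * (x - 2)"
  have sq: "side k * side k = 1" by (simp add: side_def)
  have x: "x = 2 + side k * s" and y: "y = real k + t"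
    using sq by (simp_all add: s_def t_def mult.assoc[symmetric])
  have coords: "0 \<le> t \<and> t \<le> 1 \<and> (g = straight k \<and> s = - 1 \<or> g = under_edge k \<and> s = 1 - t \<and> u = 0 \<or>
      g = over_lo k \<and> s = t \<and> t \<le> 1 / 3 \<and> u = 3 * t \<or> g = over_hi k \<and> s = t \<and> 1 / 3 \<le> t \<and> u = 3 / 2 * (1 - t))"
    if "g \<in> level k" "(x, y, u) \<in> closed_segment (fst g) (snd g)" for g u
    using level_points[OF that] sq
    by (elim disjE conjE) (simp_all add: s_def t_def mult.assoc[symmetric])
  consider "e = under_edge k" "f = over_hi k" "t = 1 / 2" "s = t" "h = 0" "h' = 3 / 4"
    | "f = under_edge k" "e = over_hi k" "t = 1 / 2" "s = t" "h' = 0" "h = 3 / 4"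
    | "e = over_lo k" "f = over_hi k" "t = 1 / 3" "s = t" "h = 1" "h' = 1"
    | "f = over_lo k" "e = over_hi k" "t = 1 / 3" "s = t" "h' = 1" "h = 1"
    using coords[OF assms(1,4)] coords[OF assms(2,5)] assms(3)
    by (elim disjE conjE) (simp_all add: field_simps)
  then show ?thesis
  proof cases
    case 1
    then show ?thesis unfolding x y by (simp add: under_pt_def over_pt_def)
  next
    case 2
    then show ?thesis unfolding x y by (simp add: under_pt_def over_pt_def)
  next
    case 3
    then show ?thesis unfolding x y by (simp add: over_lo_def over_hi_def apex_def)
  next
    case 4
    then show ?thesis unfolding x y by (simp add: over_lo_def over_hi_def apex_def)
  qed
qed

lemma closing_points:
  assumes "e \<in> closing_strand 3 m j" "(x, y, h) \<in> closed_segment (fst e) (snd e)" "j \<in> {1, 2, 3}"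
  shows "h = 0 \<and> real j - 4 \<le> y \<and> y \<le> real m + 4 - real j \<and> real j \<le> x \<and> x \<le> 7 - real j \<and>
   (e = ((real j, real m, 0), (real j, real m + 4 - real j, 0)) \<and> x = real j \<and> real m \<le> y \<or>
    e = ((real j, real m + 4 - real j, 0), (7 - real j, real m + 4 - real j, 0)) \<and> y = real m + 4 - real j \<or>
    e = ((7 - real j, real m + 4 - real j, 0), (7 - real j, real j - 4, 0)) \<and> x = 7 - real j \<or>
    e = ((7 - real j, real j - 4, 0), (real j, real j - 4, 0)) \<and> y = real j - 4 \<or>
    e = ((real j, real j - 4, 0), (real j, 0, 0)) \<and> x = real j \<and> y \<le> 0)"
proof -
  define d where "d = 4 - real j"
  have d: "1 \<le> d" "d \<le> 3" "real j = 4 - d" using assms(3) by (auto simp: d_def)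
  have "e \<in> {((4 - d, real m, 0), (4 - d, real m + d, 0)), ((4 - d, real m + d, 0), (3 + d, real m + d, 0)),
      ((3 + d, real m + d, 0), (3 + d, - d, 0)), ((3 + d, - d, 0), (4 - d, - d, 0)), ((4 - d, - d, 0), (4 - d, 0, 0))}"
    using assms(1) unfolding closing_strand_def Let_def d by simp
  then show ?thesis
    using assms(2) unfolding d
    by (elim insertE emptyE)
      (use d in \<open>auto dest!: segment_bounds simp: min_def max_def split: if_splits\<close>)
qed

lemma closing_boundary:
  assumes "e \<in> closing_strand 3 m j" "j \<in> {1, 2, 3}" "(x, y, h) \<in> closed_segment (fst e) (snd e)"
    and "0 \<le> y" "y \<le> real m" "x \<le> 3"
  shows "h = 0 \<and> (y = real m \<and> (x, y, h) = fst e \<or> y = 0 \<and> (x, y, h) = snd e)"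
  using closing_points[OF assms(1,3,2)] assms(2,4-) by auto

text \<open>The closing strands are nested: the strand of \<open>j\<close> runs along the boundary of a region that
  contains all strands of larger index in its interior.\<close>

lemma closing_disjoint:
  assumes "e \<in> closing_strand 3 m j" "f \<in> closing_strand 3 m j'" "j < j'" "j \<in> {1, 2, 3}" "j' \<in> {1, 2, 3}"
    and "(x, y, h) \<in> closed_segment (fst e) (snd e)" "(x, y, h') \<in> closed_segment (fst f) (snd f)"
  shows False
  using closing_points[OF assms(1,6,4)] closing_points[OF assms(2,7,5)] assms(3) by auto

lemma closing_meet:
  assumes "e \<in> closing_strand 3 m j" "f \<in> closing_strand 3 m j'" "e \<noteq> f" "j \<in> {1, 2, 3}" "j' \<in> {1, 2, 3}" "0 < m"
    and "(x, y, h) \<in> closed_segment (fst e) (snd e)" "(x, y, h') \<in> closed_segment (fst f) (snd f)"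
  shows "h = h' \<and> (x, y, h) \<in> {fst e, snd e} \<inter> {fst f, snd f}"
proof -
  have [simp]: "j' = j"
    using closing_disjoint[OF assms(1,2) _ assms(4,5,7,8)] closing_disjoint[OF assms(2,1) _ assms(5,4,8,7)]
    by (meson nat_neq_iff)
  define J M where "J = real j" and "M = real m"
  have JM: "1 \<le> J" "J \<le> 3" "0 < M" using assms by (auto simp: J_def M_def)
  \<comment> \<open>Naming the five edges keeps the case distinction below from comparing them coordinatewise.\<close>
  define E1 :: edge where "E1 = ((J, M, 0), (J, M + 4 - J, 0))"
  define E2 :: edge where "E2 = ((J, M + 4 - J, 0), (7 - J, M + 4 - J, 0))"
  define E3 :: edge where "E3 = ((7 - J, M + 4 - J, 0), (7 - J, J - 4, 0))"
  define E4 :: edge where "E4 = ((7 - J, J - 4, 0), (J, J - 4, 0))"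
  define E5 :: edge where "E5 = ((J, J - 4, 0), (J, 0, 0))"
  note Es = E1_def E2_def E3_def E4_def E5_def
  have coords: "u = 0 \<and> J - 4 \<le> y \<and> y \<le> M + 4 - J \<and> J \<le> x \<and> x \<le> 7 - J \<and>
      (g = E1 \<and> x = J \<and> M \<le> y \<or> g = E2 \<and> y = M + 4 - J \<or> g = E3 \<and> x = 7 - J \<or>
       g = E4 \<and> y = J - 4 \<or> g = E5 \<and> x = J \<and> y \<le> 0)"
    if "g \<in> closing_strand 3 m j" "(x, y, u) \<in> closed_segment (fst g) (snd g)" for g u
    unfolding Es J_def M_def by (rule closing_points[OF that assms(4)])
  have h0: "h = 0" "h' = 0" using coords[OF assms(1,7)] coords[OF assms(2)[simplified] assms(8)] by blast+
  consider "e = E1 \<and> f = E2 \<or> e = E2 \<and> f = E1" "x = J" "y = M + 4 - J"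
    | "e = E2 \<and> f = E3 \<or> e = E3 \<and> f = E2" "x = 7 - J" "y = M + 4 - J"
    | "e = E3 \<and> f = E4 \<or> e = E4 \<and> f = E3" "x = 7 - J" "y = J - 4"
    | "e = E4 \<and> f = E5 \<or> e = E5 \<and> f = E4" "x = J" "y = J - 4"
    using coords[OF assms(1,7)] coords[OF assms(2)[simplified] assms(8)] assms(3) JM
    by (elim conjE disjE) simp_all
  then show ?thesis
    by cases (elim disjE conjE; simp add: Es h0)+
qed

lemma level_meet_level:
  assumes "e \<in> level k" "f \<in> level l" "k < l"
    and "(x, y, h) \<in> closed_segment (fst e) (snd e)" "(x, y, h') \<in> closed_segment (fst f) (snd f)"
  shows "h = h' \<and> (x, y, h) \<in> {fst e, snd e} \<inter> {fst f, snd f}"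
proof -
  have "y = real k + 1 \<and> y = real l"
    using level_boundary[OF assms(1,4)] level_boundary[OF assms(2,5)] assms(3) by linarith
  then show ?thesis using level_boundary[OF assms(1,4)] level_boundary[OF assms(2,5)] by auto
qed

lemma level_meet_closing:
  assumes "e \<in> level k" "f \<in> closing_strand 3 m j" "k < m" "j \<in> {1, 2, 3}"
    and "(x, y, h) \<in> closed_segment (fst e) (snd e)" "(x, y, h') \<in> closed_segment (fst f) (snd f)"
  shows "h = h' \<and> (x, y, h) \<in> {fst e, snd e} \<inter> {fst f, snd f}"
proof -
  have b: "real k + 1 \<le> real m" "0 \<le> y" "y \<le> real m" "x \<le> 3"
    using level_boundary[OF assms(1,5)] assms(3) by linarith+
  have c: "h' = 0 \<and> (y = real m \<and> (x, y, h') = fst f \<or> y = 0 \<and> (x, y, h') = snd f)"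
    using closing_boundary[OF assms(2,4,6) b(2-4)] .
  moreover have "y = real k + 1" if "y = real m" using level_boundary[OF assms(1,5)] b that by linarith
  moreover have "y = real k" if "y = 0" using level_boundary[OF assms(1,5)] b that by linarith
  ultimately show ?thesis using level_boundary[OF assms(1,5)] by auto
qed

text \<open>The general position of the whole diagram in one statement: it yields both that the edges form a
  polygonal link (take \<open>p = q\<close>) and that the projection is regular.\<close>

lemma turks_head_meet:
  assumes n: "0 < n" and e: "e \<in> turks_head n" and f: "f \<in> turks_head n" and "e \<noteq> f"
    and p: "p \<in> closed_segment (fst e) (snd e)" and q: "q \<in> closed_segment (fst f) (snd f)"
    and pq: "proj p = proj q"
  shows "p = q \<and> p \<in> {fst e, snd e} \<inter> {fst f, snd f} \<or>
    (\<exists>k<2 * n. e = under_edge k \<and> f = over_hi k \<and> p = under_pt k \<and> q = over_pt k \<or>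
      f = under_edge k \<and> e = over_hi k \<and> p = over_pt k \<and> q = under_pt k)"
proof -
  obtain x y h h' where xy: "p = (x, y, h)" "q = (x, y, h')"
    using pq by (metis fst_conv proj_def prod.collapse snd_conv)
  note p = p[unfolded xy] and q = q[unfolded xy]
  from e show ?thesis
  proof (cases rule: turks_head_cases)
    case e: (level k)
    from f show ?thesis
    proof (cases rule: turks_head_cases)
      case f: (level l)
      consider "k = l" | "k < l" | "l < k" by linarith
      then show ?thesis
      proof cases
        case 1
        then show ?thesis
          using level_crossing[OF e(2) _ \<open>e \<noteq> f\<close> p q] e(1) f(2) unfolding xy by blast
      next
        case 2
        then show ?thesis using level_meet_level[OF e(2) f(2) _ p q] unfolding xy by blast
      next
        case 3
        then show ?thesis using level_meet_level[OF f(2) e(2) _ q p] unfolding xy by blast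
      qed
    next
      case f: (closing j)
      then show ?thesis using level_meet_closing[OF e(2) f(2) e(1) f(1) p q] unfolding xy by blast
    qed
  next
    case e: (closing i)
    from f show ?thesis
    proof (cases rule: turks_head_cases)
      case f: (level l)
      then show ?thesis using level_meet_closing[OF f(2) e(2) f(1) e(1) q p] unfolding xy by blast
    next
      case f: (closing j)
      have "0 < 2 * n" using n by simp
      then show ?thesis
        using closing_meet[OF e(2) f(2) \<open>e \<noteq> f\<close> e(1) f(1) _ p q] unfolding xy by blast
    qed
  qed
qed

lemma proj_inj_on_edge:
  assumes e: "e \<in> turks_head n" and p: "p \<in> closed_segment (fst e) (snd e)"
    and q: "q \<in> closed_segment (fst e) (snd e)" and pq: "proj p = proj q"
  shows "p = q"
proof -
  obtain x y h h' where xy: "p = (x, y, h)" "q = (x, y, h')"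
    using pq by (metis fst_conv proj_def prod.collapse snd_conv)
  note p = p[unfolded xy] and q = q[unfolded xy]
  from e have "h = h'"
  proof (cases rule: turks_head_cases)
    case (level k)
    from level(2) show ?thesis
      unfolding level_def
    proof (elim insertE emptyE)
      assume "e = straight k"
      then show ?thesis using in_straight p q by blast
    next
      assume "e = under_edge k"
      then show ?thesis using in_under p q by blast
    next
      assume "e = over_lo k"
      then show ?thesis using in_over_lo[of x y h k] in_over_lo[of x y h' k] p q by simp
    next
      assume "e = over_hi k"
      then show ?thesis using in_over_hi[of x y h k] in_over_hi[of x y h' k] p q by simp
    qed
  next
    case (closing j)
    then show ?thesis using closing_points p q by metis
  qed
  then show ?thesis by (simp add: xy)
qed

lemma level_subset: "k < 2 * n \<Longrightarrow> level k \<subseteq> turks_head n"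
  by (auto simp: turks_head_def)

lemma level_in_turks_head:
  assumes "k < 2 * n"
  shows "straight k \<in> turks_head n" "under_edge k \<in> turks_head n" "over_lo k \<in> turks_head n" "over_hi k \<in> turks_head n"
  using level_subset[OF assms] by (auto simp: level_def)

lemma under_pt_in: "under_pt k \<in> closed_segment (fst (under_edge k)) (snd (under_edge k))"
  unfolding under_pt_def under_edge_def fst_conv snd_conv in_segment_triple
  by (intro exI[of _ "1 / 2"]) (simp add: field_simps)

lemma over_pt_in: "over_pt k \<in> closed_segment (fst (over_hi k)) (snd (over_hi k))"
  unfolding over_pt_def over_hi_def apex_def fst_conv snd_conv in_segment_triple
  by (intro exI[of _ "1 / 4"]) (simp add: field_simps)

lemma under_pt_inj: "under_pt k = under_pt l \<Longrightarrow> k = l"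
  by (simp add: under_pt_def)

lemma height_crossing: "height (under_pt k) = 0" "height (over_pt k) = 3 / 4"
  by (simp_all add: height_def under_pt_def over_pt_def)

lemma proj_crossing: "proj (over_pt k) = proj (under_pt k)"
  by (simp add: proj_def under_pt_def over_pt_def)

lemma in_carrier_iff: "x \<in> carrier_of E \<longleftrightarrow> (\<exists>e\<in>E. x \<in> closed_segment (fst e) (snd e))"
  by (simp add: carrier_of_def case_prod_beta)

lemma double_point:
  assumes n: "0 < n" and xy: "x \<in> carrier_of (turks_head n)" "y \<in> carrier_of (turks_head n)" "proj x = proj y" "x \<noteq> y"
  obtains k where "k < 2 * n" "x = under_pt k \<and> y = over_pt k \<or> x = over_pt k \<and> y = under_pt k"
proof -
  obtain e f where ef: "e \<in> turks_head n" "x \<in> closed_segment (fst e) (snd e)"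
    "f \<in> turks_head n" "y \<in> closed_segment (fst f) (snd f)"
    using xy(1,2) unfolding in_carrier_iff by blast
  then have "e \<noteq> f" using proj_inj_on_edge xy(3,4) by blast
  from turks_head_meet[OF n ef(1,3) this ef(2,4) xy(3)] xy(4) that show ?thesis by blast
qed

lemma crossing_in_carrier:
  assumes "k < 2 * n"
  shows "under_pt k \<in> carrier_of (turks_head n)" "over_pt k \<in> carrier_of (turks_head n)"
  using level_in_turks_head[OF assms] under_pt_in over_pt_in unfolding in_carrier_iff by blast+

lemma crosses_over_turks_head:
  assumes "0 < n"
  shows "crosses_over (turks_head n) y x \<longleftrightarrow> (\<exists>k<2 * n. x = under_pt k \<and> y = over_pt k)"
proof
  assume c: "crosses_over (turks_head n) y x"
  then have "x \<noteq> y" by (auto simp: crosses_over_def)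
  then obtain k where "k < 2 * n" "x = under_pt k \<and> y = over_pt k \<or> x = over_pt k \<and> y = under_pt k"
    using double_point[OF assms, of x y] c unfolding crosses_over_def by metis
  then show "\<exists>k<2 * n. x = under_pt k \<and> y = over_pt k"
    using c by (auto simp: crosses_over_def height_crossing)
next
  assume "\<exists>k<2 * n. x = under_pt k \<and> y = over_pt k"
  then show "crosses_over (turks_head n) y x"
    using crossing_in_carrier by (auto simp: crosses_over_def height_crossing proj_crossing)
qed

lemma fiber_crossing:
  assumes k: "k < 2 * n"
  shows "fiber (turks_head n) (proj (under_pt k)) = {under_pt k, over_pt k}"
proof
  show "{under_pt k, over_pt k} \<subseteq> fiber (turks_head n) (proj (under_pt k))"
    using crossing_in_carrier[OF k] by (simp add: fiber_def proj_crossing)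
  show "fiber (turks_head n) (proj (under_pt k)) \<subseteq> {under_pt k, over_pt k}"
  proof
    fix z assume "z \<in> fiber (turks_head n) (proj (under_pt k))"
    then have z: "z \<in> carrier_of (turks_head n)" "proj z = proj (under_pt k)" by (simp_all add: fiber_def)
    have n: "0 < n" using k by simp
    show "z \<in> {under_pt k, over_pt k}"
    proof (cases "z = under_pt k")
      case False
      then obtain l where "z = under_pt l \<and> under_pt k = over_pt l \<or> z = over_pt l \<and> under_pt k = under_pt l"
        using double_point[OF n z(1) crossing_in_carrier(1)[OF k] z(2)] k by metis
      moreover have "under_pt k \<noteq> over_pt l" using height_crossing[of k] height_crossing[of l] by auto
      ultimately show ?thesis using under_pt_inj by blast
    qed simp
  qed
qed

text \<open>The crossings have half-integral \<open>y\<close>-coordinate, so this keeps them away from the vertices.\<close>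

lemma start_y:
  assumes "e \<in> turks_head n"
  obtains i :: int where "fst (snd (fst e)) = of_int i \<or> fst (snd (fst e)) = of_int i + 1 / 3"
  using assms
proof (cases rule: turks_head_cases)
  case (level k)
  then show ?thesis using that[of "int k"] by (auto simp: level_def edge_defs)
next
  case (closing j)
  have "\<exists>i. fst (snd (fst e)) = real_of_int i"
    using closing(2) unfolding closing_strand_def Let_def
    by (elim insertE emptyE)
      (auto intro: exI[of _ "2 * int n"] exI[of _ "2 * int n + 4 - int j"] exI[of _ "int j - 4"])
  then show ?thesis using that by blast
qed

lemma crossing_not_vertex:
  assumes "e \<in> turks_head n"
  shows "fst e \<noteq> under_pt k" "fst e \<noteq> over_pt k"
proof -
  obtain i :: int where i: "fst (snd (fst e)) = of_int i \<or> fst (snd (fst e)) = of_int i + 1 / 3"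
    using start_y[OF assms] .
  have "real k + 1 / 2 \<noteq> of_int i"
  proof
    assume "real k + 1 / 2 = of_int i"
    then have "real_of_int (2 * int k + 1) = real_of_int (2 * i)" by simp
    then show False unfolding of_int_eq_iff by presburger
  qed
  moreover have "real k + 1 / 2 \<noteq> of_int i + 1 / 3"
  proof
    assume "real k + 1 / 2 = of_int i + 1 / 3"
    then have "real_of_int (6 * int k + 3) = real_of_int (6 * i + 2)" by simp
    then show False unfolding of_int_eq_iff by presburger
  qed
  ultimately show "fst e \<noteq> under_pt k" "fst e \<noteq> over_pt k"
    using i by (auto simp: under_pt_def over_pt_def)
qed

lemma regular_position_turks_head:
  assumes "0 < n"
  shows "regular_position (turks_head n)"
proof -
  have mp: "multiple_points (turks_head n) \<subseteq> (\<lambda>k. proj (under_pt k)) ` {..<2 * n}"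
  proof
    fix q assume "q \<in> multiple_points (turks_head n)"
    then obtain x y where xy: "x \<in> fiber (turks_head n) q" "y \<in> fiber (turks_head n) q" "x \<noteq> y"
      unfolding multiple_points_def by blast
    then obtain k where k: "k < 2 * n" "x = under_pt k \<and> y = over_pt k \<or> x = over_pt k \<and> y = under_pt k"
      using double_point[OF assms, of x y] unfolding fiber_def by auto
    have "proj x = q" using xy(1) by (simp add: fiber_def)
    with k(2) have "q = proj (under_pt k)" by (elim disjE conjE) (simp_all add: proj_crossing)
    then show "q \<in> (\<lambda>k. proj (under_pt k)) ` {..<2 * n}" by (rule image_eqI) (simp add: k(1))
  qed
  show ?thesis unfolding regular_position_def
  proof (intro conjI ballI)
    show "finite (multiple_points (turks_head n))" using mp finite_surj by blast
  next
    fix q assume "q \<in> multiple_points (turks_head n)"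
    then obtain k where k: "k < 2 * n" "q = proj (under_pt k)" using mp by blast
    have "under_pt k \<noteq> over_pt k" using height_crossing[of k] by auto
    then show "card (fiber (turks_head n) q) = 2" by (simp add: k fiber_crossing)
    show "fiber (turks_head n) q \<inter> fst ` turks_head n = {}"
    proof (rule equals0I, elim IntE imageE)
      fix x e assume "x \<in> fiber (turks_head n) q" "x = fst e" "e \<in> turks_head n"
      then show False
        using crossing_not_vertex[of e n k] unfolding k(2) fiber_crossing[OF k(1)] by simp
    qed
  qed
qed

section \<open>The diagram as a polygonal link\<close>

lemma level_ends_y:
  assumes "e \<in> level k"
  shows "real k \<le> fst (snd (fst e))" "fst (snd (fst e)) < real k + 1"
    "real k < fst (snd (snd e))" "fst (snd (snd e)) \<le> real k + 1"
  using assms by (auto simp: level_def edge_defs)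

lemma closing_ends_y:
  assumes "e \<in> closing_strand 3 m j" "j \<in> {1, 2, 3}"
  shows "real m \<le> fst (snd (fst e)) \<or> fst (snd (fst e)) < 0"
    "real m < fst (snd (snd e)) \<or> fst (snd (snd e)) \<le> 0"
  using assms unfolding closing_strand_def Let_def by (elim insertE emptyE; simp)+

lemma closing_same_strand:
  assumes "e \<in> closing_strand 3 m i" "i \<in> {1, 2, 3}" "f \<in> closing_strand 3 m j" "j \<in> {1, 2, 3}"
    and "p \<in> {fst e, snd e}" "p \<in> {fst f, snd f}"
  shows "i = j"
proof -
  obtain x y h where p: "p = (x, y, h)" by (metis prod_cases3)
  have "p \<in> closed_segment (fst e) (snd e)" "p \<in> closed_segment (fst f) (snd f)"
    using assms(5,6) by auto
  then show ?thesis
    using closing_disjoint[OF assms(1,3) _ assms(2,4)] closing_disjoint[OF assms(3,1) _ assms(4,2)]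
    unfolding p by (meson nat_neq_iff)
qed

lemma closing_inj:
  assumes "j \<in> {1, 2, 3}"
  shows "inj_on fst (closing_strand 3 m j)" "inj_on snd (closing_strand 3 m j)"
proof -
  define J M where "J = real j" and "M = real m"
  have "1 \<le> J" "J \<le> 3" "0 \<le> M" using assms by (auto simp: J_def M_def)
  moreover have eq: "closing_strand 3 m j = {((J, M, 0), (J, M + (4 - J), 0)), ((J, M + (4 - J), 0), (7 - J, M + (4 - J), 0)),
    ((7 - J, M + (4 - J), 0), (7 - J, - (4 - J), 0)), ((7 - J, - (4 - J), 0), (J, - (4 - J), 0)), ((J, - (4 - J), 0), (J, 0, 0))}"
    by (simp add: closing_strand_def Let_def J_def M_def)
  ultimately show "inj_on fst (closing_strand 3 m j)" "inj_on snd (closing_strand 3 m j)"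
    unfolding eq by (simp_all; linarith)+
qed

lemma level_inj: "inj_on fst (level k)" "inj_on snd (level k)"
  by (cases k rule: side_cases; simp add: level_def edge_defs)+

lemma turks_head_inj: "inj_on fst (turks_head n)" "inj_on snd (turks_head n)"
proof -
  have "e = f" if e: "e \<in> turks_head n" and f: "f \<in> turks_head n" and same: "fst e = fst f \<or> snd e = snd f" for e f
    using e
  proof (cases rule: turks_head_cases)
    case e: (level k)
    from f show ?thesis
    proof (cases rule: turks_head_cases)
      case f: (level l)
      have "real k < real l + 1" "real l < real k + 1"
        using same level_ends_y[OF e(2)] level_ends_y[OF f(2)] by (elim disjE; simp)+
      then have "k = l" by linarith
      then show ?thesis using same level_inj[of k] e(2) f(2) by (auto dest: inj_onD)
    next
      case f: (closing j)
      have "real k + 1 \<le> real (2 * n)" using e(1) by linarith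
      then have False
        using same level_ends_y[OF e(2)] closing_ends_y[OF f(2,1)] by (elim disjE; simp)
      then show ?thesis ..
    qed
  next
    case e: (closing i)
    from f show ?thesis
    proof (cases rule: turks_head_cases)
      case f: (level l)
      have "real l + 1 \<le> real (2 * n)" using f(1) by linarith
      then have False
        using same level_ends_y[OF f(2)] closing_ends_y[OF e(2,1)] by (elim disjE; simp)
      then show ?thesis ..
    next
      case f: (closing j)
      have "i = j"
        using same closing_same_strand[OF e(2,1) f(2,1), of "fst e"] closing_same_strand[OF e(2,1) f(2,1), of "snd e"]
        by auto
      then show ?thesis using same closing_inj[OF f(1), of "2 * n"] e(2) f(2) by (auto dest: inj_onD)
    qed
  qed
  then show "inj_on fst (turks_head n)" "inj_on snd (turks_head n)" unfolding inj_on_def by blast+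
qed

lemma position_is_end:
  assumes "j \<in> {1, 2, 3 :: nat}" "k < 2 * n"
  shows "(real j, real k + 1, 0) \<in> snd ` turks_head n"
proof -
  have "snd (straight k) = (2 - side k, real k + 1, 0)" "snd (under_edge k) = (2, real k + 1, 0)"
    "snd (over_hi k) = (2 + side k, real k + 1, 0)"
    by (simp_all add: edge_defs)
  then have "{(2 - side k, real k + 1, 0), (2, real k + 1, 0), (2 + side k, real k + 1, 0)} \<subseteq> snd ` turks_head n"
    using level_in_turks_head[OF assms(2)] by (metis empty_subsetI image_eqI insert_subset)
  moreover have "(real j, real k + 1, 0) \<in> {(2 - side k, real k + 1, 0), (2, real k + 1, 0), (2 + side k, real k + 1, 0 :: real)}"
    using assms(1) by (cases k rule: side_cases) auto
  ultimately show ?thesis by blast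
qed

lemma position_zero_is_end:
  assumes "j \<in> {1, 2, 3 :: nat}"
  shows "(real j, 0, 0) \<in> snd ` turks_head n"
proof -
  have "((real j, - (real 3 + 1 - real j), 0), (real j, 0, 0)) \<in> turks_head n"
    using assms unfolding turks_head_def closing_strand_def Let_def by blast
  then show ?thesis by force
qed

text \<open>No two edges share their start and no two share their end, so the two sets have the same size and one
  inclusion is enough. The edge ending at a given vertex is found one level below, or in a closing
  strand.\<close>

lemma turks_head_starts_eq_ends:
  assumes "0 < n"
  shows "fst ` turks_head n = snd ` turks_head n"
proof (rule card_subset_eq)
  have fin: "finite (turks_head n)"
    by (auto simp: turks_head_def level_def closing_strand_def Let_def)
  then show "finite (snd ` turks_head n)" by simp
  show "card (fst ` turks_head n) = card (snd ` turks_head n)"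
    using turks_head_inj[of n] by (simp add: card_image)
  have pos: "(real j, real k, 0) \<in> snd ` turks_head n" if "j \<in> {1, 2, 3 :: nat}" "k \<le> 2 * n" for j k
  proof (cases k)
    case 0
    then show ?thesis using position_zero_is_end[OF that(1)] by simp
  next
    case (Suc l)
    then show ?thesis using position_is_end[OF that(1), of l n] that(2) by (simp add: add.commute)
  qed
  show "fst ` turks_head n \<subseteq> snd ` turks_head n"
  proof (rule image_subsetI)
    fix e assume "e \<in> turks_head n"
    then show "fst e \<in> snd ` turks_head n"
    proof (cases rule: turks_head_cases)
      case (level k)
      have "apex k = snd (over_lo k)" by (simp add: over_lo_def)
      then have "apex k \<in> snd ` turks_head n" using level_in_turks_head[OF level(1)] by blast
      then have "{(1, real k, 0), (2, real k, 0), (3, real k, 0), apex k} \<subseteq> snd ` turks_head n"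
        using pos[of 1 k] pos[of 2 k] pos[of 3 k] level(1) by simp
      moreover have "fst e \<in> {(1, real k, 0), (2, real k, 0), (3, real k, 0), apex k}"
        using level(2) by (cases k rule: side_cases) (auto simp: level_def edge_defs)
      ultimately show ?thesis by (rule subsetD)
    next
      case (closing j)
      have "snd ` closing_strand 3 (2 * n) j \<subseteq> snd ` turks_head n"
        using closing(1) unfolding turks_head_def by blast
      then have "insert (real j, real (2 * n), 0) (snd ` closing_strand 3 (2 * n) j) \<subseteq> snd ` turks_head n"
        using pos[OF closing(1) order_refl] by (rule insert_subsetI[rotated])
      moreover have "fst e \<in> insert (real j, real (2 * n), 0) (snd ` closing_strand 3 (2 * n) j)"
        using closing(2) by (auto simp: closing_strand_def Let_def)
      ultimately show ?thesis by (rule subsetD)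
    qed
  qed
qed

lemma turks_head_common_point:
  assumes "0 < n" "e \<in> turks_head n" "f \<in> turks_head n" "e \<noteq> f"
    and "p \<in> closed_segment (fst e) (snd e)" "p \<in> closed_segment (fst f) (snd f)"
  shows "p \<in> {fst e, snd e} \<inter> {fst f, snd f}"
proof -
  have ne: "under_pt k \<noteq> over_pt k" for k using height_crossing[of k] by auto
  show ?thesis
    using turks_head_meet[OF assms refl]
  proof (elim disjE exE conjE)
    fix k assume "p = under_pt k" "p = over_pt k"
    then show ?thesis using ne[of k] by simp
  next
    fix k assume "p = over_pt k" "p = under_pt k"
    then show ?thesis using ne[of k] by simp
  qed
qed

lemma polygonal_link_turks_head:
  assumes "0 < n"
  shows "polygonal_link (turks_head n)"
  unfolding polygonal_link_def case_prod_beta prod.collapse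
proof (intro conjI ballI impI turks_head_inj turks_head_starts_eq_ends[OF assms])
  show "finite (turks_head n)"
    by (auto simp: turks_head_def level_def closing_strand_def Let_def)
  show "turks_head n \<noteq> {}" using level_in_turks_head(1)[of 0 n] assms by auto
next
  fix e assume "e \<in> turks_head n"
  then show "fst e \<noteq> snd e"
  proof (cases rule: turks_head_cases)
    case (level k)
    then show ?thesis by (auto simp: level_def edge_defs)
  next
    case (closing j)
    then show ?thesis unfolding closing_strand_def Let_def by (elim insertE emptyE; simp)
  qed
next
  fix e f assume ef: "e \<in> turks_head n" "f \<in> turks_head n" "e \<noteq> f"
  show "closed_segment (fst e) (snd e) \<inter> closed_segment (fst f) (snd f) \<subseteq> {fst e, snd e} \<inter> {fst f, snd f}"
  proof
    fix x assume "x \<in> closed_segment (fst e) (snd e) \<inter> closed_segment (fst f) (snd f)"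
    then show "x \<in> {fst e, snd e} \<inter> {fst f, snd f}"
      using turks_head_common_point[OF assms ef] by blast
  qed
qed

section \<open>Coloring the diagram by a recurrent sequence\<close>

lemma periodic_mod:
  fixes c :: "nat \<Rightarrow> 'a"
  assumes "\<And>k. c (k + m) = c k"
  shows "c (k mod m + i) = c (k + i)"
proof -
  have "c (a + b * m) = c a" for a b
  proof (induction b)
    case (Suc b)
    then show ?case using assms[of "a + b * m"] by (simp add: algebra_simps)
  qed simp
  from this[of "k mod m + i" "k div m"] show ?thesis
    by (metis add.assoc add.commute mod_div_mult_eq)
qed

text \<open>Colors of the standard diagram in the order in which its arcs are born: at level \<open>k\<close> an arc of color
  \<open>c k\<close> ends under the arc of color \<open>c (k + 2)\<close>, where the arc of color \<open>c (k + 3)\<close> begins. The Fox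
  relation at the crossing is the recurrence; its characteristic polynomial
  \<open>t\<^sup>3 - 2 t\<^sup>2 + 1 = (t - 1) (t\<^sup>2 - t - 1)\<close> is the reason why Fibonacci numbers appear.\<close>

definition coloring_sequence :: "nat \<Rightarrow> nat \<Rightarrow> (nat \<Rightarrow> int) \<Rightarrow> bool" where
  "coloring_sequence r n c \<longleftrightarrow>
     (\<forall>k. c k \<in> {0..<int r}) \<and> (\<forall>k. c (k + 2 * n) = c k) \<and>
     (\<forall>k. [c (k + 3) + c k = 2 * c (k + 2)] (mod int r)) \<and> 2 \<le> card (range c)"

lemma coloring_sequence_mod:
  fixes g :: "nat \<Rightarrow> int"
  assumes "0 < r" and "\<And>k. [g (k + 2 * n) = g k] (mod int r)"
    and "\<And>k. [g (k + 3) + g k = 2 * g (k + 2)] (mod int r)"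
    and "\<not> [g i = g j] (mod int r)"
  shows "coloring_sequence r n (\<lambda>k. g k mod int r)"
proof -
  let ?c = "\<lambda>k. g k mod int r"
  have "range ?c \<subseteq> {0..<int r}" using assms(1) by auto
  then have "finite (range ?c)" by (rule finite_subset) simp
  moreover have "{?c i, ?c j} \<subseteq> range ?c" by blast
  moreover have "card {?c i, ?c j} = 2" using assms(4) by (simp add: cong_def)
  ultimately have "2 \<le> card (range ?c)" by (metis card_mono)
  then show ?thesis
    using assms(1-3) unfolding coloring_sequence_def
    by (auto simp: cong_def mod_simps)
qed

lemma card_range_periodic:
  fixes c :: "nat \<Rightarrow> 'a"
  assumes "\<And>k. c (k + h) = c k" "0 < h"
  shows "card (range c) \<le> h"
proof -
  have "range c \<subseteq> c ` {..<h}"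
  proof
    fix v assume "v \<in> range c"
    then obtain k where "v = c k" by blast
    then have "v = c (k mod h)" using periodic_mod[of c h k 0, OF assms(1)] by simp
    then show "v \<in> c ` {..<h}" using assms(2) by simp
  qed
  then have "card (range c) \<le> card (c ` {..<h})" by (rule card_mono[rotated]) simp
  also have "\<dots> \<le> h" using card_image_le[of "{..<h}" c] by simp
  finally show ?thesis .
qed

text \<open>The strands at the line \<open>y = k\<close>: in the middle the coming over-strand, on the side \<open>2 + side k\<close> the
  coming under-strand, on the other side the strand that level \<open>k\<close> leaves alone.\<close>

definition position_color :: "(nat \<Rightarrow> int) \<Rightarrow> nat \<Rightarrow> real \<Rightarrow> int" where
  "position_color c k x = (if x = 2 then c (k + 2) else if x = 2 - side k then c (k + 1) else c k)"

text \<open>Height \<open>1\<close> marks the apex of an over-strand. The last case concerns the corners of the closing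
  strand of \<open>j\<close>, whose \<open>x\<close>-coordinate is \<open>j\<close> or \<open>7 - j\<close>.\<close>

fun vertex_color :: "nat \<Rightarrow> (nat \<Rightarrow> int) \<Rightarrow> point \<Rightarrow> int" where
  "vertex_color n c (x, y, h) =
    (if h = 1 then c (nat \<lfloor>y\<rfloor> + 2)
     else if x \<le> 3 \<and> 0 \<le> y \<and> y \<le> real (2 * n) then position_color c (nat \<lfloor>y\<rfloor>) x
     else position_color c 0 (if x \<le> 3 then x else 7 - x))"

lemma vertex_color_position:
  assumes "k \<le> 2 * n" "x \<le> 3"
  shows "vertex_color n c (x, real k, 0) = position_color c k x"
proof -
  have "real k \<le> real (2 * n)" using assms(1) by linarith
  then show ?thesis using assms(2) by simp
qed

lemma vertex_color_apex: "vertex_color n c (apex k) = c (k + 2)"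
proof -
  have "\<lfloor>real k + 1 / 3\<rfloor> = int k" by (rule floor_unique) auto
  then show ?thesis by (simp add: apex_def)
qed

lemma vertex_color_level:
  assumes "k < 2 * n"
  shows "vertex_color n c (fst (straight k)) = c (k + 1)" "vertex_color n c (snd (straight k)) = c (k + 1)"
    "vertex_color n c (fst (under_edge k)) = c k" "vertex_color n c (snd (under_edge k)) = c (k + 3)"
    "vertex_color n c (fst (over_lo k)) = c (k + 2)" "vertex_color n c (snd (over_lo k)) = c (k + 2)"
    "vertex_color n c (fst (over_hi k)) = c (k + 2)" "vertex_color n c (snd (over_hi k)) = c (k + 2)"
proof -
  have start: "vertex_color n c (x, real k, 0) = position_color c k x"
    and stop: "vertex_color n c (x, real k + 1, 0) = position_color c (Suc k) x" if "x \<le> 3" for x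
    using vertex_color_position[of k n x c] vertex_color_position[of "Suc k" n x c] assms that
    by (simp_all add: add.commute)
  have s: "2 - side k \<le> 3" "2 + side k \<le> 3" "side k \<noteq> 0"
    by (cases k rule: side_cases; simp)+
  show "vertex_color n c (fst (straight k)) = c (k + 1)" "vertex_color n c (snd (straight k)) = c (k + 1)"
    "vertex_color n c (fst (under_edge k)) = c k" "vertex_color n c (snd (under_edge k)) = c (k + 3)"
    "vertex_color n c (fst (over_lo k)) = c (k + 2)" "vertex_color n c (snd (over_lo k)) = c (k + 2)"
    "vertex_color n c (fst (over_hi k)) = c (k + 2)" "vertex_color n c (snd (over_hi k)) = c (k + 2)"
    unfolding straight_def under_edge_def over_lo_def over_hi_def fst_conv snd_conv
    using s by (simp_all only: start stop vertex_color_apex) (auto simp: position_color_def side_Suc numeral_3_eq_3)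
qed

text \<open>Periodicity makes the colors at the top and at the bottom of the braid agree. The
  closing strands impose no other condition.\<close>

lemma vertex_color_closing:
  assumes per: "\<And>k. c (k + 2 * n) = c k" and e: "e \<in> closing_strand 3 (2 * n) j" "j \<in> {1, 2, 3}"
  shows "vertex_color n c (fst e) = position_color c 0 (real j) \<and> vertex_color n c (snd e) = position_color c 0 (real j)"
proof -
  have j: "1 \<le> real j" "real j \<le> 3" using e(2) by auto
  have "side (2 * n) = side 0" by (simp add: side_def)
  moreover have "c (2 * n + 2) = c 2" "c (2 * n + 1) = c 1" "c (2 * n) = c 0"
    using per[of 2] per[of 1] per[of 0] by (simp_all add: add.commute)
  ultimately have pos: "position_color c (2 * n) (real j) = position_color c 0 (real j)"
    by (simp add: position_color_def numeral_2_eq_2)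
  have ends: "vertex_color n c (real j, real (2 * n), 0) = position_color c 0 (real j)"
    "vertex_color n c (real j, 0, 0) = position_color c 0 (real j)"
    using vertex_color_position[of "2 * n" n "real j" c] vertex_color_position[of 0 n "real j" c] j pos
    by simp_all
  have outside: "vertex_color n c (x, y, 0) = position_color c 0 (real j)"
    if "x = real j \<and> (y < 0 \<or> real (2 * n) < y) \<or> x = 7 - real j" for x y
    using that j by auto
  have d: "real 3 + (real 3 + 1 - real j) = 7 - real j" by simp
  show ?thesis
    using e(1) unfolding closing_strand_def Let_def d
    by (elim insertE emptyE) (simp_all only: fst_conv snd_conv ends, (intro conjI outside; use j in simp)+)
qed

lemma vertex_color_constant:
  assumes "\<And>k. c (k + 2 * n) = c k" "e \<in> turks_head n" "\<And>k. k < 2 * n \<Longrightarrow> e \<noteq> under_edge k"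
  shows "vertex_color n c (fst e) = vertex_color n c (snd e)"
  using assms(2)
proof (cases rule: turks_head_cases)
  case (level k)
  then have "e = straight k \<or> e = over_lo k \<or> e = over_hi k" using assms(3) by (auto simp: level_def)
  then show ?thesis using vertex_color_level[OF level(1), of c] by (elim disjE) (simp_all only:)
next
  case (closing j)
  then show ?thesis using vertex_color_closing[of c n, OF assms(1) closing(2,1)] by simp
qed

lemma crossing_edge:
  assumes "0 < n" "e \<in> turks_head n" "k < 2 * n"
  shows "under_pt k \<in> closed_segment (fst e) (snd e) \<Longrightarrow> e = under_edge k"
    and "over_pt k \<in> closed_segment (fst e) (snd e) \<Longrightarrow> e = over_hi k"
proof -
  have not_end: "{under_pt k, over_pt k} \<inter> {fst e, snd e} = {}"
  proof -
    have "{fst e, snd e} \<subseteq> fst ` turks_head n"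
      using assms(2) turks_head_starts_eq_ends[OF assms(1)] by blast
    moreover have "under_pt k \<notin> fst ` turks_head n" "over_pt k \<notin> fst ` turks_head n"
      using crossing_not_vertex[of _ n k] by fastforce+
    ultimately show ?thesis by blast
  qed
  note lev = level_in_turks_head[OF assms(3)]
  show "e = under_edge k" if "under_pt k \<in> closed_segment (fst e) (snd e)"
    using turks_head_common_point[OF assms(1,2) lev(2) _ that under_pt_in] not_end by blast
  show "e = over_hi k" if "over_pt k \<in> closed_segment (fst e) (snd e)"
    using turks_head_common_point[OF assms(1,2) lev(4) _ that over_pt_in] not_end by blast
qed

lemma vertex_color_range:
  assumes per: "\<And>k. c (k + 2 * n) = c k" and "0 < n"
  shows "vertex_color n c ` fst ` turks_head n = range c"
proof
  show "vertex_color n c ` fst ` turks_head n \<subseteq> range c"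
    by (auto simp: position_color_def)
  show "range c \<subseteq> vertex_color n c ` fst ` turks_head n"
  proof clarify
    fix m
    \<comment> \<open>The level whose over-strand has color \<open>c m\<close>; adding \<open>2 n\<close> first avoids a truncated subtraction.\<close>
    define k where "k = (m + 2 * n - 2) mod (2 * n)"
    have k: "k < 2 * n" using assms(2) by (simp add: k_def)
    have "c (k + 2) = c (m + 2 * n - 2 + 2)" unfolding k_def by (rule periodic_mod[of c "2 * n", OF per])
    also have "m + 2 * n - 2 + 2 = m + 2 * n" using assms(2) by simp
    finally have "c m = vertex_color n c (fst (over_lo k))"
      using vertex_color_level(5)[OF k] per by simp
    then show "c m \<in> vertex_color n c ` fst ` turks_head n" using level_in_turks_head(3)[OF k] by blast
  qed
qed

text \<open>At level \<open>k\<close> the over-strand has color \<open>c (k + 2)\<close> at all its vertices and the under-strand leads from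
  color \<open>c k\<close> to \<open>c (k + 3)\<close>, so the Fox condition at its crossing is the recurrence.\<close>

lemma mincol_THK3_le:
  assumes "0 < n" and c: "coloring_sequence r n c"
  shows "mincol r (THK3 n) \<le> enat (card (range c))"
proof -
  have res: "c k \<in> {0..<int r}" and per: "c (k + 2 * n) = c k"
    and rel: "[c (k + 3) + c k = 2 * c (k + 2)] (mod int r)" and two: "2 \<le> card (range c)" for k
    using c unfolding coloring_sequence_def by blast+
  let ?E = "turks_head n" and ?v = "vertex_color n c"
  have under: "\<exists>k<2 * n. x = under_pt k \<and> y = over_pt k \<and> (a, b) = under_edge k"
    if "(a, b) \<in> ?E" "x \<in> closed_segment a b" "crosses_over ?E y x" for a b x y
    using that crossing_edge(1)[OF assms(1) that(1)] by (auto simp: crosses_over_turks_head[OF assms(1)])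
  obtain col where col: "fox_coloring r ?E col" "col ` arcs ?E = ?v ` fst ` ?E"
  proof (rule vertex_coloring_extends[OF polygonal_link_turks_head regular_position_turks_head])
    show "?v ` fst ` ?E \<subseteq> {0..<int r}" unfolding vertex_color_range[of c n, OF per assms(1)] using res by blast
  next
    fix a b x x' y y'
    assume "(a, b) \<in> ?E" "x \<in> closed_segment a b" "x' \<in> closed_segment a b"
      "crosses_over ?E y x" "crosses_over ?E y' x'"
    then obtain k l where "x = under_pt k" "x' = under_pt l" "(a, b) = under_edge k" "(a, b) = under_edge l"
      using under by meson
    moreover from this have "k = l" by (simp add: under_edge_def)
    ultimately show "x = x'" by simp
  next
    fix a b assume ab: "(a, b) \<in> ?E" and no: "\<And>x y. x \<in> closed_segment a b \<Longrightarrow> \<not> crosses_over ?E y x"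
    have "(a, b) \<noteq> under_edge k" if k: "k < 2 * n" for k
    proof
      assume eq: "(a, b) = under_edge k"
      have "under_pt k \<in> closed_segment a b" using under_pt_in[of k] unfolding eq[symmetric] by simp
      moreover have "crosses_over ?E (over_pt k) (under_pt k)"
        using k unfolding crosses_over_turks_head[OF assms(1)] by blast
      ultimately show False using no by blast
    qed
    then show "?v a = ?v b" using vertex_color_constant[of c n, OF per ab] by simp
  next
    fix a b d e x y
    assume ab: "(a, b) \<in> ?E" and de: "(d, e) \<in> ?E" and x: "x \<in> closed_segment a b"
      and y: "y \<in> closed_segment d e" and "crosses_over ?E y x"
    then obtain k where k: "k < 2 * n" "y = over_pt k" "(a, b) = under_edge k" using under by blast
    then have "(d, e) = over_hi k" using crossing_edge(2)[OF assms(1) de k(1)] y by simp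
    then have "?v a = c k" "?v b = c (k + 3)" "?v d = c (k + 2)" "?v e = c (k + 2)"
      using vertex_color_level[OF k(1), of c] k(3) by (metis fst_conv snd_conv)+
    then show "?v d = ?v e \<and> [2 * ?v d - ?v a - ?v b = 0] (mod int r)"
      using cong_diff[OF rel[of k] cong_refl[of "c (k + 3) + c k"]]
      by (simp add: cong_sym_eq algebra_simps)
  qed (use assms(1) in auto)
  have "num_colors ?E col = card (range c)"
    unfolding num_colors_def col(2) vertex_color_range[of c n, OF per assms(1)] ..
  then show ?thesis
    using mincol_le_num_colors[OF polygonal_link_turks_head regular_position_turks_head col(1)] assms(1) two
    by (simp add: THK3_def closed_braid_turks_head)
qed

section \<open>Fibonacci numbers modulo a prime\<close>

lemma fib_recurrence_int: "int (fib (k + 2)) = int (fib (k + 1)) + int (fib k)"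
  by (simp add: fib_plus_2)

lemma Cassini_at:
  assumes "0 < q"
  shows "int (fib (q + 1)) * int (fib (q - 1)) - int (fib q) ^ 2 = (- 1) ^ q"
  using fib_Cassini_int[of "q - 1"] assms by (cases q) auto

lemma fib_double: "int (fib (2 * k)) = int (fib k) * (int (fib (k + 1)) + int (fib (k - 1)))"
proof (cases k)
  case (Suc l)
  have "fib (2 * k) = fib (Suc (l + Suc l))" using Suc by (intro arg_cong[of _ _ fib]) simp
  also have "\<dots> = fib (Suc (Suc l)) * fib (Suc l) + fib (Suc l) * fib l" by (rule fib_add)
  finally have "fib (2 * k) = fib k * (fib (k + 1) + fib (k - 1))"
    using Suc by (simp add: algebra_simps del: fib.simps)
  then show ?thesis by (simp only: of_nat_mult of_nat_add)
qed simp

lemma fib_double_Suc: "int (fib (2 * k + 1)) = int (fib (k + 1)) ^ 2 + int (fib k) ^ 2"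
  using fib_add[of k k] by (simp add: mult_2 power2_eq_square del: fib.simps)

lemma u_int_fib: "u_int n = int (fib (n + 2)) + (- 1) ^ n * int (fib n)"
  using of_int_u_int[of n] unfolding u_real_fib of_int_eq_iff .

text \<open>The divisibility in the definition of \<open>\<psi>\<close> concerns Fibonacci numbers at even and Lucas numbers
  \<open>F\<^bsub>q+1\<^esub> + F\<^bsub>q-1\<^esub>\<close> at odd indices.\<close>

lemma u_int_pred:
  assumes "0 < q"
  shows "u_int (q - 1) = (if even q then int (fib q) else int (fib (q + 1)) + int (fib (q - 1)))"
  using assms by (cases q) (auto simp: u_int_fib)

text \<open>Among consecutive pairs of residues two agree by the pigeonhole principle; running the recurrence
  backwards moves the coincidence to index \<open>0\<close>.\<close>

lemma exists_fib_dvd: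
  assumes "0 < p"
  obtains m where "0 < m" "int p dvd int (fib m)"
proof -
  have descend: "[int (fib d) = 0] (mod int p)"
    if "[int (fib i) = int (fib (i + d))] (mod int p)" "[int (fib (i + 1)) = int (fib (i + 1 + d))] (mod int p)" for i d
    using that
  proof (induction i)
    case 0
    then show ?case by (simp add: cong_sym_eq)
  next
    case (Suc i)
    have "[int (fib (i + 2)) - int (fib (i + 1)) = int (fib (i + d + 2)) - int (fib (i + d + 1))] (mod int p)"
      using cong_diff[OF Suc.prems(2,1)] by (simp del: fib.simps)
    then have "[int (fib i) = int (fib (i + d))] (mod int p)" by (simp only: fib_recurrence_int) simp
    then show ?case using Suc by simp
  qed
  define f where "f k = (fib k mod p, fib (k + 1) mod p)" for k
  have "f ` {..p * p} \<subseteq> {..<p} \<times> {..<p}" using assms by (auto simp: f_def)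
  then have "card (f ` {..p * p}) \<le> p * p"
    using card_mono[of "{..<p} \<times> {..<p}" "f ` {..p * p}"] by (simp add: card_cartesian_product)
  then have "\<not> inj_on f {..p * p}" by (intro pigeonhole) simp
  then obtain i j where "i < j" "f i = f j" unfolding inj_on_def by (metis nat_neq_iff)
  then have "[int (fib i) = int (fib (i + (j - i)))] (mod int p)"
    "[int (fib (i + 1)) = int (fib (i + 1 + (j - i)))] (mod int p)"
    by (simp_all add: f_def cong_int_iff) (simp_all add: cong_def)
  then have "int p dvd int (fib (j - i))" using descend unfolding cong_0_iff by blast
  then show ?thesis using that[of "j - i"] \<open>i < j\<close> by simp
qed

lemma psi_prop:
  assumes "0 < p"
  shows "0 < psi p" "int p dvd u_int (psi p - 1)"
    and "\<And>q. 0 < q \<Longrightarrow> q < psi p \<Longrightarrow> \<not> int p dvd u_int (q - 1)"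
proof -
  obtain m where m: "0 < m" "int p dvd int (fib m)" using exists_fib_dvd[OF assms] .
  have "int p dvd u_int (2 * m - 1)"
    using u_int_pred[of "2 * m"] m fib_double[of m] by (simp del: of_nat_mult of_nat_add)
  then have "0 < 2 * m \<and> int p dvd u_int (2 * m - 1)" using m by simp
  then have "0 < psi p \<and> int p dvd u_int (psi p - 1)" unfolding psi_def by (rule LeastI)
  then show "0 < psi p" "int p dvd u_int (psi p - 1)" by auto
  show "\<not> int p dvd u_int (q - 1)" if "0 < q" "q < psi p" for q
    using not_less_Least[of q "\<lambda>q. 0 < q \<and> int p dvd u_int (q - 1)"] that unfolding psi_def by blast
qed

lemma fermat_theorem_int:
  assumes "prime p" "\<not> int p dvd a"
  shows "[a ^ (p - 1) = 1] (mod int p)"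
proof -
  define b where "b = nat (a mod int p)"
  have "0 < p" using assms(1) prime_gt_0_nat by blast
  then have b: "int b = a mod int p" by (simp add: b_def)
  then have ab: "[int b = a] (mod int p)" by simp
  then have "\<not> p dvd b" using assms(2) cong_dvd_iff[of "int b" a "int p"] cong_dvd_modulus cong_0_iff
    by (metis cong_sym cong_trans of_nat_dvd_iff)
  then have "[b ^ (p - 1) = 1] (mod p)" using fermat_theorem[OF assms(1)] by blast
  then have "[int b ^ (p - 1) = 1] (mod int p)" using cong_int_iff[of "b ^ (p - 1)" 1 p] by simp
  then show ?thesis using cong_pow[OF ab, of "p - 1"] by (meson cong_sym cong_trans)
qed

text \<open>If \<open>q = \<psi>(p)\<close> is odd, then \<open>F\<^bsub>q-1\<^esub> = - f\<close> and \<open>F\<^sub>q = 2 f\<close> modulo \<open>p\<close> with \<open>f = F\<^bsub>q+1\<^esub>\<close>, and Cassini's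
  identity becomes \<open>5 f\<^sup>2 = 1\<close>. So \<open>5\<close> has the square root \<open>5 f\<close>, and \<open>\<phi> = (1 + 5 f) / 2\<close> is a root of
  \<open>t\<^sup>2 = t + 1\<close>. Its powers form a coloring sequence. Of the two roots this is the one with \<open>\<phi>\<^sup>q = 1\<close>
  (for the other one the power is \<open>- 1\<close>). As \<open>q\<close> is odd, \<open>\<phi> = (\<phi>\<^bsup>(q+1)/2\<^esup>)\<^sup>2\<close> is a square, and the powers
  stay among the \<open>(p - 1) / 2\<close> nonzero squares.\<close>

lemma odd_psi_coloring:
  fixes p :: nat
  assumes "prime p" "2 < p" "odd (psi p)"
  obtains c where "coloring_sequence p (psi p) c" "card (range c) \<le> (p - 1) div 2"
proof -
  define q where "q = psi p"
  define f where "f = int (fib (q + 1))"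
  define g where "g = int (fib (q - 1))"
  have q: "0 < q" "odd q" using psi_prop(1)[of p] assms by (auto simp: q_def)
  have Fq: "int (fib q) = f - g" using fib_recurrence_int[of "q - 1"] q by (simp add: f_def g_def)
  have pp: "prime (int p)" using assms(1) by simp
  have "odd p" using assms by (simp add: prime_odd_nat)
  have "int p dvd f + g"
    using psi_prop(2)[of p] assms u_int_pred[OF q(1)] q(2) by (simp add: f_def g_def q_def)
  then obtain t where g: "g = int p * t - f" by (metis add_diff_cancel_left' dvd_def)
  have "f * g - (f - g) ^ 2 = - 1" using Cassini_at[OF q(1)] q(2) by (simp add: Fq f_def g_def)
  then have "5 * f ^ 2 = 1 + int p * (5 * f * t - int p * t ^ 2)"
    unfolding g by (simp add: power2_eq_square algebra_simps)
  then have f5: "[5 * f ^ 2 = 1] (mod int p)" by (simp add: cong_iff_dvd_diff)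
  \<comment> \<open>\<open>(p + 1) / 2\<close> is the inverse of \<open>2\<close> modulo \<open>p\<close>.\<close>
  define \<phi> where "\<phi> = (1 + 5 * f) * ((int p + 1) div 2)"
  have "2 * ((int p + 1) div 2) = int p + 1"
    by (rule dvd_mult_div_cancel) (use \<open>odd p\<close> in simp)
  then have phi2: "2 * \<phi> = (1 + 5 * f) * (int p + 1)" unfolding \<phi>_def by (simp add: mult.left_commute)
  have two_phi: "[2 * \<phi> = 1 + 5 * f] (mod int p)"
    unfolding phi2 by (simp add: cong_iff_dvd_diff algebra_simps)
  have cop: "coprime 4 (int p)"
  proof -
    have "coprime (2 ^ 2) (int p)" using \<open>odd p\<close> by (simp only: coprime_power_left_iff) simp
    then show ?thesis by simp
  qed
  have phi_sq: "[\<phi> ^ 2 = \<phi> + 1] (mod int p)"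
  proof -
    have "[(2 * \<phi>) ^ 2 = (1 + 5 * f) ^ 2] (mod int p)" by (rule cong_pow[OF two_phi])
    also have "(1 + 5 * f) ^ 2 = 1 + 10 * f + 5 * (5 * f ^ 2)" by (simp add: power2_eq_square algebra_simps)
    also have "[1 + 10 * f + 5 * (5 * f ^ 2) = 1 + 10 * f + 5 * 1] (mod int p)"
      by (intro cong_add cong_mult f5 cong_refl)
    also have "1 + 10 * f + 5 * 1 = 2 * (1 + 5 * f) + 4" by simp
    also have "[2 * (1 + 5 * f) + 4 = 2 * (2 * \<phi>) + 4] (mod int p)"
      by (intro cong_add cong_mult cong_refl cong_sym[OF two_phi])
    finally have "[4 * \<phi> ^ 2 = 4 * (\<phi> + 1)] (mod int p)" by (simp add: power_mult_distrib algebra_simps)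
    then show ?thesis using cong_mult_lcancel[OF cop] by blast
  qed
  have phi_pow: "[\<phi> ^ Suc m = int (fib (Suc m)) * \<phi> + int (fib m)] (mod int p)" for m
  proof (induction m)
    case (Suc m)
    have "[\<phi> * \<phi> ^ Suc m = \<phi> * (int (fib (Suc m)) * \<phi> + int (fib m))] (mod int p)"
      by (intro cong_mult cong_refl Suc)
    also have "\<phi> * (int (fib (Suc m)) * \<phi> + int (fib m)) = int (fib (Suc m)) * \<phi> ^ 2 + int (fib m) * \<phi>"
      by (simp add: power2_eq_square algebra_simps)
    also have "[\<dots> = int (fib (Suc m)) * (\<phi> + 1) + int (fib m) * \<phi>] (mod int p)"
      by (intro cong_add cong_mult cong_refl phi_sq)
    finally show ?case by (simp add: algebra_simps)
  qed simp
  have phi_q: "[\<phi> ^ q = 1] (mod int p)"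
  proof -
    have "[\<phi> ^ q = (f - g) * \<phi> + g] (mod int p)"
      using phi_pow[of "q - 1"] q unfolding Fq[symmetric] by (simp add: g_def)
    also have "(f - g) * \<phi> + g = (f * (2 * \<phi>) - f) + int p * (t - t * \<phi>)"
      unfolding g by (simp add: algebra_simps)
    also have "[\<dots> = (f * (1 + 5 * f) - f) + 0] (mod int p)"
      by (intro cong_add cong_diff cong_mult cong_refl two_phi) (simp add: cong_0_iff)
    also have "f * (1 + 5 * f) - f + 0 = 5 * f ^ 2" by (simp add: power2_eq_square algebra_simps)
    also note f5
    finally show ?thesis .
  qed
  define h where "h = (p - 1) div 2"
  have h: "2 * h = p - 1" "0 < h" using \<open>odd p\<close> assms(2) by (auto simp: h_def)
  have phi_h: "[\<phi> ^ h = 1] (mod int p)"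
  proof -
    have "\<not> int p dvd \<phi>"
    proof
      assume "int p dvd \<phi>"
      then have "int p dvd \<phi> ^ q" using q(1) by (simp add: dvd_power_le dvd_trans[OF _ dvd_power])
      then have "int p dvd 1" using phi_q cong_dvd_iff cong_sym by (metis cong_0_iff cong_trans)
      then show False using pp not_prime_unit by blast
    qed
    then have fermat: "[\<phi> ^ (2 * h) = 1] (mod int p)"
      using fermat_theorem_int[OF assms(1)] h(1) by simp
    \<comment> \<open>Both \<open>\<phi>\<^sup>q = 1\<close> and Fermat's theorem enter: \<open>h + q h = 2 h (q + 1) / 2\<close> is a multiple of \<open>p - 1\<close>.\<close>
    have "odd q" by (rule q)
    then have "\<phi> ^ h * \<phi> ^ (q * h) = (\<phi> ^ (2 * h)) ^ ((q + 1) div 2)"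
      unfolding power_mult[symmetric] power_add[symmetric]
      by (intro arg_cong[of _ _ "\<lambda>k. \<phi> ^ k"]) (auto elim!: oddE simp: algebra_simps)
    moreover have "[(\<phi> ^ (2 * h)) ^ ((q + 1) div 2) = 1] (mod int p)" using cong_pow[OF fermat] by simp
    moreover have "[\<phi> ^ h * \<phi> ^ (q * h) = \<phi> ^ h * 1] (mod int p)"
      using cong_pow[OF phi_q, of h] by (intro cong_mult cong_refl) (simp add: power_mult)
    ultimately show ?thesis by (metis cong_sym cong_trans mult.right_neutral)
  qed
  let ?c = "\<lambda>k. \<phi> ^ k mod int p"
  have per: "[\<phi> ^ (k + h) = \<phi> ^ k] (mod int p)" for k
    using cong_mult[OF cong_refl[of "\<phi> ^ k"] phi_h] by (simp add: power_add)
  have "coloring_sequence p q ?c"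
  proof (rule coloring_sequence_mod[of p _ _ 1 0])
    show "0 < p" using assms by simp
    show "[\<phi> ^ (k + 2 * q) = \<phi> ^ k] (mod int p)" for k
      using cong_mult[OF cong_refl[of "\<phi> ^ k"] cong_pow[OF phi_q, of 2]]
      by (simp add: power_add power_mult mult.commute)
    show "[\<phi> ^ (k + 3) + \<phi> ^ k = 2 * \<phi> ^ (k + 2)] (mod int p)" for k
    proof -
      have "\<phi> ^ (k + 3) + \<phi> ^ k - 2 * \<phi> ^ (k + 2) = \<phi> ^ k * (\<phi> - 1) * (\<phi> ^ 2 - (\<phi> + 1))"
        by (simp add: power_add power2_eq_square power3_eq_cube algebra_simps)
      then show ?thesis using phi_sq by (simp add: cong_iff_dvd_diff)
    qed
    show "\<not> [\<phi> ^ 1 = \<phi> ^ 0] (mod int p)"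
    proof
      assume "[\<phi> ^ 1 = \<phi> ^ 0] (mod int p)"
      then have one: "[\<phi> = 1] (mod int p)" by simp
      have "[1 ^ 2 = 1 + 1] (mod int p)"
        using cong_pow[OF one, of 2] phi_sq cong_add[OF one cong_refl[of 1]] by (meson cong_sym cong_trans)
      then have "int p dvd 1" by (simp add: cong_iff_dvd_diff)
      then show False using pp not_prime_unit by blast
    qed
  qed
  moreover have "card (range ?c) \<le> h"
    by (rule card_range_periodic) (use per h in \<open>auto simp: cong_def\<close>)
  ultimately show ?thesis using that[of ?c] by (simp add: q_def h_def)
qed

text \<open>The hypotheses say that the pair at index \<open>q\<close> is the negative of the pair \<open>(F\<^sub>0, F\<^sub>1)\<close>.\<close>

lemma fib_antiperiodic:
  assumes "[int (fib q) = 0] (mod p)" "[int (fib (q + 1)) = - 1] (mod p)"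
  shows "[int (fib (m + q)) = - int (fib m)] (mod p)"
proof -
  have "[int (fib (m + q)) = - int (fib m)] (mod p) \<and> [int (fib (m + 1 + q)) = - int (fib (m + 1))] (mod p)"
  proof (induction m)
    case 0
    then show ?case using assms by (simp add: add.commute)
  next
    case (Suc m)
    then have "[int (fib (m + 1 + q)) + int (fib (m + q)) = - int (fib (m + 1)) + - int (fib m)] (mod p)"
      by (intro cong_add) simp_all
    then have "[int (fib (m + q + 2)) = - int (fib (m + 2))] (mod p)"
      by (simp only: fib_recurrence_int) (simp add: algebra_simps)
    then show ?case using Suc by (simp del: fib.simps)
  qed
  then show ?thesis ..
qed

text \<open>This combines the antiperiod with \<open>F\<^bsub>-m\<^esub> = - (- 1)\<^sup>m F\<^sub>m\<close>.\<close>

lemma fib_reflect: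
  assumes "[int (fib q) = 0] (mod p)" "[int (fib (q + 1)) = - 1] (mod p)" "m \<le> q"
  shows "[int (fib (q - m)) = (- 1) ^ m * int (fib m)] (mod p)"
  using assms(3)
proof (induction m rule: fib.induct)
  case 1
  then show ?case using assms(1) by simp
next
  case 2
  have "[int (fib (q + 1)) - int (fib q) = - 1 - 0] (mod p)" by (intro cong_diff assms)
  moreover have "int (fib (q + 1)) - int (fib q) = int (fib (q - 1))"
    using 2 fib_recurrence_int[of "q - 1"] by simp
  ultimately show ?case by simp
next
  case (3 m)
  have "[int (fib (q - m)) - int (fib (q - Suc m)) = (- 1) ^ m * int (fib m) - (- 1) ^ Suc m * int (fib (Suc m))] (mod p)"
    using 3 by (intro cong_diff) simp_all
  moreover have "int (fib (q - m)) - int (fib (q - Suc m)) = int (fib (q - Suc (Suc m)))"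
    using 3(3) fib_recurrence_int[of "q - Suc (Suc m)"] by (simp add: Suc_diff_Suc numeral_2_eq_2 del: fib.simps)
  ultimately show ?case by (simp add: algebra_simps)
qed

text \<open>A period has \<open>q\<close> even and \<open>q\<close> odd indices, and the antiperiod and the reflection identify most of
  the values in pairs. Even indices may be reduced to \<open>0, 2, \<dots>\<close> up to \<open>q / 2\<close>, up to sign of the value, which
  leaves \<open>1 + 2 (q div 4)\<close> values; for odd indices the reflection changes the sign, so the signs are absorbed by
  the odd indices below \<open>q\<close>, which leaves \<open>q / 2\<close> values. The set \<open>S\<close> of values common to both parities is
  counted twice.\<close>

lemma fib_range_card:
  fixes q r :: nat
  assumes q: "even q" "0 < q" and F: "[int (fib q) = 0] (mod int r)" "[int (fib (q + 1)) = - 1] (mod int r)"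
    and c: "\<And>k. c k = int (fib k) mod int r"
    and S: "S \<subseteq> c ` {k. even k} \<inter> c ` {k. odd k}"
  shows "card (range c) + card S \<le> 1 + 2 * (q div 4) + q div 2"
proof -
  have shift: "c (k + q) = (- int (fib k)) mod int r" for k
    using fib_antiperiodic[OF F] by (simp add: c cong_def)
  have reflect: "c (q - k) = ((- 1) ^ k * int (fib k)) mod int r" if "k \<le> q" for k
    using fib_reflect[OF F that] by (simp add: c cong_def)
  have per: "c (k + 2 * q) = c k" for k
  proof -
    have "[int (fib (k + q + q)) = - (- int (fib k))] (mod int r)"
      using fib_antiperiodic[OF F, of "k + q"] fib_antiperiodic[OF F, of k]
      unfolding cong_minus_minus_iff[of "int (fib (k + q))", symmetric] by (rule cong_trans)
    then show ?thesis by (simp add: c cong_def mult_2 add.assoc)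
  qed
  have mod_per: "c k = c (k mod (2 * q))" for k using periodic_mod[of c "2 * q" k 0, OF per] by simp
  define T where "T = (\<lambda>j. 2 * j) ` {1..q div 4}"
  define Ev where "Ev = insert 0 (c ` T \<union> (\<lambda>k. (- int (fib k)) mod int r) ` T)"
  define Od where "Od = (\<lambda>j. c (2 * j + 1)) ` {..<q div 2}"
  have even_half: "c k \<in> Ev \<and> (- int (fib k)) mod int r \<in> Ev" if "even k" "k \<le> q div 2" for k
  proof (cases "k = 0")
    case True
    then show ?thesis by (simp add: c Ev_def)
  next
    case False
    then have "k div 2 \<in> {1..q div 4}" "k = 2 * (k div 2)" using that by (auto elim!: evenE)
    then have "k \<in> T" unfolding T_def by blast
    then show ?thesis by (auto simp: Ev_def)
  qed
  have even_below: "c k \<in> Ev \<and> (- int (fib k)) mod int r \<in> Ev" if "even k" "k < q" for k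
  proof (cases "k \<le> q div 2")
    case False
    have e: "even (q - k)" "q - k \<le> q div 2" using that q False by auto
    have "c (q - k) = c k" using reflect[of k] that by (simp add: c)
    moreover from this have "(- int (fib (q - k))) mod int r = (- int (fib k)) mod int r"
      by (simp add: c) (metis mod_minus_eq)
    ultimately show ?thesis using even_half[OF e] by simp
  qed (use that even_half in blast)
  have evens: "c k \<in> Ev" if "even k" for k
  proof -
    define l where "l = k mod (2 * q)"
    have l: "even l" "l < 2 * q" using that q(2) by (simp_all add: l_def dvd_mod)
    have "c l \<in> Ev"
    proof (cases "l < q")
      case False
      then have "c l = (- int (fib (l - q))) mod int r" using shift[of "l - q"] by simp
      then show ?thesis using even_below[of "l - q"] l q False by auto
    qed (use l even_below in blast)
    then show ?thesis using mod_per[of k] by (simp add: l_def)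
  qed
  have odd_below: "c k \<in> Od" if "odd k" "k < q" for k
  proof -
    have "k = 2 * (k div 2) + 1" "k div 2 < q div 2" using that q by (auto elim!: evenE oddE)
    then show ?thesis unfolding Od_def by (metis imageI lessThan_iff)
  qed
  have odds: "c k \<in> Od" if "odd k" for k
  proof -
    define l where "l = k mod (2 * q)"
    have l: "odd l" "l < 2 * q" using that q(2) by (simp_all add: l_def dvd_mod_iff)
    have "c l \<in> Od"
    proof (cases "l < q")
      case False
      define a where "a = l - q"
      have a: "odd a" "a < q" using l q False by (auto simp: a_def)
      have "c l = (- int (fib a)) mod int r" using shift[of a] False by (simp add: a_def)
      also have "\<dots> = c (q - a)" using reflect[of a] a by simp
      finally show ?thesis using odd_below[of "q - a"] a q odd_pos[of a] by simp
    qed (use l odd_below in blast)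
    then show ?thesis using mod_per[of k] by (simp add: l_def)
  qed
  have "card (c ` T \<union> (\<lambda>k. (- int (fib k)) mod int r) ` T) \<le> card T + card T"
    by (rule order_trans[OF card_Un_le add_mono]) (simp_all add: card_image_le T_def)
  moreover have "card T \<le> q div 4" using card_image_le[of "{1..q div 4}" "\<lambda>j. 2 * j"] by (simp add: T_def)
  ultimately have cE: "card Ev \<le> 1 + 2 * (q div 4)"
    unfolding Ev_def using card_insert_le_m1 by (simp add: card_insert_if T_def)
  have cO: "card Od \<le> q div 2"
    using card_image_le[of "{..<q div 2}"] unfolding Od_def by fastforce
  have fin: "finite Ev" "finite Od" by (simp_all add: Ev_def Od_def T_def)
  have "range c \<subseteq> Ev \<union> Od" using evens odds by blast
  moreover have "S \<subseteq> Ev \<inter> Od"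
    by (rule order_trans[OF S Int_mono]) (use evens odds in auto)
  ultimately have "card (range c) \<le> card (Ev \<union> Od)" "card S \<le> card (Ev \<inter> Od)"
    using fin by (auto intro!: card_mono)
  then show ?thesis using card_Un_Int[OF fin] cE cO by linarith
qed

text \<open>If \<open>q = \<psi>(p) = 2 k\<close>, then \<open>p\<close> divides \<open>F\<^sub>q = F\<^sub>k (F\<^bsub>k+1\<^esub> + F\<^bsub>k-1\<^esub>)\<close>, and minimality of \<open>q\<close> excludes the first
  factor for even \<open>k\<close> and the second one for odd \<open>k\<close>. Either way Cassini's identity gives \<open>F\<^bsub>q+1\<^esub> = - 1\<close> modulo \<open>p\<close>,
  so that modulo \<open>p\<close> the Fibonacci sequence has antiperiod \<open>q\<close>. Values common to both parities of the index are \<open>F\<^sub>1 = F\<^sub>2\<close>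
  and its negative. For odd \<open>k\<close> there are three more, \<open>F\<^sub>0 = F\<^sub>k = 0\<close> and \<open>\<plusminus> x\<close> with
  \<open>x = F\<^bsub>k+1\<^esub> = F\<^bsub>k+2\<^esub>\<close>; they are new because \<open>x\<^sup>2 = - 1\<close>.\<close>

lemma even_psi_coloring:
  fixes p :: nat
  assumes "prime p" "2 < p" "even (psi p)"
  obtains c where "coloring_sequence p (psi p) c"
    and "4 dvd psi p \<Longrightarrow> card (range c) + 1 \<le> psi p"
    and "\<not> 4 dvd psi p \<Longrightarrow> card (range c) + 5 \<le> psi p"
proof -
  define q where "q = psi p"
  define k where "k = q div 2"
  have q: "0 < q" "even q" using psi_prop(1)[of p] assms by (auto simp: q_def)
  then have k: "q = 2 * k" "0 < k" "k < q" by (auto simp: k_def)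
  have pp: "prime (int p)" using assms(1) by simp
  have "int p dvd int (fib q)"
    using psi_prop(2)[of p] assms u_int_pred[OF q(1)] q(2) by (simp add: q_def)
  then have Fq: "[int (fib q) = 0] (mod int p)" by (simp add: cong_0_iff)
  define x where "x = int (fib (k + 1))"
  define y where "y = int (fib (k - 1))"
  have Fk: "int (fib k) = x - y" using fib_recurrence_int[of "k - 1"] k by (simp add: x_def y_def)
  have cas: "x * y - int (fib k) ^ 2 = (- 1) ^ k" using Cassini_at[OF k(2)] by (simp add: x_def y_def)
  have Fq1: "int (fib (q + 1)) = x ^ 2 + int (fib k) ^ 2" using fib_double_Suc[of k] k by (simp add: x_def)
  have "int p dvd int (fib k) * (x + y)"
    using \<open>int p dvd int (fib q)\<close> fib_double[of k] k by (simp add: x_def y_def)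
  then have split: "int p dvd int (fib k) \<or> int p dvd x + y" using pp by (simp add: prime_dvd_mult_iff)
  have small: "\<not> int p dvd (if even k then int (fib k) else x + y)"
  proof -
    have "\<not> int p dvd u_int (k - 1)"
      using psi_prop(3)[of p k] assms(2) k(2,3) unfolding q_def by linarith
    then show ?thesis unfolding u_int_pred[OF k(2)] x_def y_def .
  qed
  have unit: "\<not> int p dvd 1" "\<not> int p dvd 2"
  proof -
    show "\<not> int p dvd 1" using pp not_prime_unit by blast
    show "\<not> int p dvd 2" using assms(2) zdvd_imp_le[of "int p" 2] by auto
  qed
  have neg1: "[int (fib (q + 1)) = - 1] (mod int p)"
  proof (cases "even k")
    case True
    then have "int p dvd x + y" using split small by simp
    moreover have "int (fib (q + 1)) - - 1 = x * (x + y)"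
      using cas True unfolding Fq1 by (simp add: power2_eq_square algebra_simps)
    ultimately show ?thesis by (simp add: cong_iff_dvd_diff)
  next
    case False
    then have "int p dvd int (fib k)" using split small by simp
    moreover have "int (fib (q + 1)) - - 1 = int (fib k) * (x + 2 * int (fib k))"
      using cas False unfolding Fq1 Fk by (simp add: power2_eq_square algebra_simps)
    ultimately show ?thesis by (simp add: cong_iff_dvd_diff)
  qed
  define c where "c m = int (fib m) mod int p" for m
  have cs: "coloring_sequence p q c"
    unfolding c_def
  proof (rule coloring_sequence_mod[of p _ _ 1 0])
    show "0 < p" using assms by simp
    show "[int (fib (m + 2 * q)) = int (fib m)] (mod int p)" for m
    proof -
      have "[int (fib (m + q + q)) = - (- int (fib m))] (mod int p)"
        using fib_antiperiodic[OF Fq neg1, of "m + q"] fib_antiperiodic[OF Fq neg1, of m]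
        unfolding cong_minus_minus_iff[of "int (fib (m + q))", symmetric] by (rule cong_trans)
      then show ?thesis by (simp add: mult_2 add.assoc)
    qed
    show "[int (fib (m + 3)) + int (fib m) = 2 * int (fib (m + 2))] (mod int p)" for m
    proof -
      have "int (fib (m + 3)) + int (fib m) = 2 * int (fib (m + 2))"
        by (simp add: numeral_3_eq_3)
      then show ?thesis by (simp only: cong_refl)
    qed
    show "\<not> [int (fib 1) = int (fib 0)] (mod int p)" using unit by (simp add: cong_0_iff)
  qed
  note bound = fib_range_card[OF q(2,1) Fq neg1, of c, OF c_def]
  have both: "v mod int p \<in> c ` {m. even m} \<inter> c ` {m. odd m}"
    if "[int (fib i) = v] (mod int p)" "[int (fib j) = v] (mod int p)" "even i" "odd j" for v i j
  proof -
    have "v mod int p = c i" "v mod int p = c j" using that by (simp_all add: c_def cong_def)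
    then show ?thesis using that(3,4) by blast
  qed
  have minus: "[int (fib (i + q)) = - v] (mod int p)" if "[int (fib i) = v] (mod int p)" for i v
    using fib_antiperiodic[OF Fq neg1, of i] that cong_minus_minus_iff cong_trans by blast
  have one: "1 mod int p \<in> c ` {m. even m} \<inter> c ` {m. odd m}"
    by (rule both[of 2 _ 1]) simp_all
  have mone: "(- 1) mod int p \<in> c ` {m. even m} \<inter> c ` {m. odd m}"
    by (rule both[OF minus minus, of 2 _ 1]) (use q in simp_all)
  have ne1: "1 mod int p \<noteq> (- 1) mod int p"
    using unit by (simp flip: cong_def add: cong_iff_dvd_diff)
  have "card (range c) + 1 \<le> q" if "4 dvd q"
  proof -
    have "card (range c) + card {1 mod int p, (- 1) mod int p} \<le> 1 + 2 * (q div 4) + q div 2"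
      by (rule bound) (use one mone in blast)
    then show ?thesis using that ne1 by (auto elim!: dvdE)
  qed
  moreover have "card (range c) + 5 \<le> q" if "\<not> 4 dvd q"
  proof -
    have "odd k" using that k by auto
    then have "int p dvd int (fib k)" using split small by simp
    then have Fk0: "[int (fib k) = 0] (mod int p)" by (simp add: cong_0_iff)
    have x1: "[int (fib (k + 1)) = x] (mod int p)" by (simp add: x_def)
    have x2: "[int (fib (k + 2)) = x] (mod int p)"
      using cong_add[OF x1 Fk0] by (simp only: fib_recurrence_int) simp
    have "int p dvd x ^ 2 + 1"
    proof -
      have "x ^ 2 + 1 = int (fib k) * (x + int (fib k))"
        using cas \<open>odd k\<close> unfolding Fk by (simp add: power2_eq_square algebra_simps)
      then show ?thesis using \<open>int p dvd int (fib k)\<close> by simp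
    qed
    have sq: "\<not> int p dvd x - 1" "\<not> int p dvd x + 1" "\<not> int p dvd x"
    proof -
      have "2 = (x ^ 2 + 1) - (x - 1) * (x + 1)" "1 = (x ^ 2 + 1) - x * x"
        by (simp_all add: power2_eq_square algebra_simps)
      then show "\<not> int p dvd x - 1" "\<not> int p dvd x + 1" "\<not> int p dvd x"
        using \<open>int p dvd x ^ 2 + 1\<close> unit by (metis dvd_diff dvd_mult dvd_mult2)+
    qed
    have sq2: "\<not> int p dvd 2 * x" using sq unit pp by (simp add: prime_dvd_mult_iff)
    let ?S = "(\<lambda>v. v mod int p) ` set [0, 1, - 1, x, - x]"
    have "\<not> int p dvd 0 - 1" "\<not> int p dvd 0 - - 1" "\<not> int p dvd 0 - x" "\<not> int p dvd 0 - - x"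
      "\<not> int p dvd 1 - - 1" "\<not> int p dvd 1 - x" "\<not> int p dvd 1 - - x"
      "\<not> int p dvd - 1 - x" "\<not> int p dvd - 1 - - x" "\<not> int p dvd x - - x"
      using sq sq2 unit dvd_minus_iff[of "int p" "x - 1"] dvd_minus_iff[of "int p" "x + 1"]
      by (simp_all add: add.commute)
    then have "distinct (map (\<lambda>v. v mod int p) [0, 1, - 1, x, - x])"
      unfolding cong_iff_dvd_diff[symmetric] cong_def
      by (simp only: list.map distinct.simps list.set insert_iff empty_iff) simp
    then have "card (set (map (\<lambda>v. v mod int p) [0, 1, - 1, x, - x])) = 5" by (simp only: distinct_card) simp
    then have card: "card ?S = 5" by (simp only: set_map)
    have zero: "0 mod int p \<in> c ` {m. even m} \<inter> c ` {m. odd m}"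
      by (rule both[of 0 _ k]) (use Fk0 \<open>odd k\<close> in simp_all)
    have xs: "x mod int p \<in> c ` {m. even m} \<inter> c ` {m. odd m}"
      by (rule both[OF x1 x2]) (use \<open>odd k\<close> in simp_all)
    have mxs: "(- x) mod int p \<in> c ` {m. even m} \<inter> c ` {m. odd m}"
      by (rule both[OF minus[OF x1] minus[OF x2]]) (use \<open>odd k\<close> q in simp_all)
    have "?S \<subseteq> c ` {m. even m} \<inter> c ` {m. odd m}"
      unfolding set_simps image_insert image_empty using zero one mone xs mxs by blast
    from bound[OF this] card have "card (range c) + 5 \<le> 1 + 2 * (q div 4) + q div 2" by simp
    moreover have "q mod 4 = 2" using that q by presburger
    ultimately show ?thesis by presburger
  qed
  ultimately show ?thesis using that cs unfolding q_def by blast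
qed

section \<open>The bounds\<close>

theorem theorem1p3:
  fixes p :: nat
  assumes "prime p" and "p > 11"
  shows
    "(odd (psi p) \<longrightarrow>
        ([5 ^ ((p - 1) div 2) = - 1] (mod int p) \<longrightarrow>
           mincol p (THK3 (psi p)) \<le> enat ((p + 1) div 2)) \<and>
        ([5 ^ ((p - 1) div 2) = 1] (mod int p) \<longrightarrow>
           mincol p (THK3 (psi p)) \<le> enat ((p - 1) div 2))) \<and>
     (even (psi p) \<longrightarrow>
        (4 dvd psi p \<longrightarrow>
           mincol p (THK3 (psi p)) + 1 \<le> enat (psi p)) \<and>
        (\<not> 4 dvd psi p \<longrightarrow>
           mincol p (THK3 (psi p)) + 5 \<le> enat (psi p)))"
proof -
  have pos: "0 < psi p" using psi_prop(1)[of p] assms(2) by simp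
  have odd_case: "mincol p (THK3 (psi p)) \<le> enat m" if psi: "odd (psi p)" and m: "(p - 1) div 2 \<le> m" for m
  proof -
    obtain c where "coloring_sequence p (psi p) c" "card (range c) \<le> (p - 1) div 2"
      using odd_psi_coloring[OF assms(1) _ psi] assms(2) by auto
    then show ?thesis
      using mincol_THK3_le[OF pos] m by (meson enat_ord_simps(1) order_trans)
  qed
  have even_case: "(4 dvd psi p \<longrightarrow> mincol p (THK3 (psi p)) + 1 \<le> enat (psi p)) \<and>
      (\<not> 4 dvd psi p \<longrightarrow> mincol p (THK3 (psi p)) + 5 \<le> enat (psi p))" if psi: "even (psi p)"
  proof -
    obtain c where c: "coloring_sequence p (psi p) c"
      and card: "4 dvd psi p \<Longrightarrow> card (range c) + 1 \<le> psi p"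
        "\<not> 4 dvd psi p \<Longrightarrow> card (range c) + 5 \<le> psi p"
      using even_psi_coloring[OF assms(1) _ psi] assms(2) by auto
    have add: "mincol p (THK3 (psi p)) + enat i \<le> enat (psi p)" if "card (range c) + i \<le> psi p" for i
    proof -
      have "mincol p (THK3 (psi p)) + enat i \<le> enat (card (range c)) + enat i"
        by (rule add_right_mono) (rule mincol_THK3_le[OF pos c])
      also have "\<dots> \<le> enat (psi p)" using that by simp
      finally show ?thesis .
    qed
    show ?thesis
      using add[OF card(1)] add[OF card(2)] by (simp add: one_enat_def numeral_eq_enat)
  qed
  show ?thesis using odd_case even_case by simp
qed

end
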